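(* Let $q$ be a prime power with $q\neq 2,3$. For every integer $r\geq 1$, there exists an infinite, non-trivial $F$-set in $\mathbb{F}_q[X]$ of width exactly $r$.
   Context: Let $q$ be a prime power and let $I_q$ denote the set of monic nonconstant irreducible polynomials in $\mathbb{F}_q[X]$. An $F$-set (in $\mathbb{F}_q[X]$) is a subset $A\subseteq I_q$ such that, for every $f\in A$, all monic irreducible divisors of $f(X)-f(0)$ belong to $A$. An $F$-set is non-trivial if it is different from $I_q$. The nullity of an $F$-set $A$ is $$N(A)=\{f\in A: f\nmid g(X)-g(0)\text{ for every }g\in A\}.$$ It is known that $A\setminus N(A)$ is again an $F$-set. The nullity filtration of $A$ is defined by $A^{(0)}=A$ and $A^{(n+1)}=A^{(n)}\setminus N(A^{(n)})$ for $n\geq 0$. The width $w(A)$ is the least $n\geq 0$ for which $A^{(n)}$ is finite, if such an $n$ exists; otherwise $w(A)=\infty$. *)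

theory Defs
  imports
    "HOL-Computational_Algebra.Computational_Algebra"
    "HOL-Library.Cardinality"
    "HOL-Library.Extended_Nat"
begin

text \<open>
  The field with \<open>q\<close> elements is a type \<open>'a\<close> of sort \<open>{field, finite}\<close>
  with \<open>q = CARD('a)\<close>; such a cardinality is automatically a prime power.
\<close>

definition monic_irreducibles :: "'a :: {field, finite} poly set"
  where "monic_irreducibles = {f. lead_coeff f = 1 \<and> degree f > 0 \<and> irreducible f}"

definition minus_const :: "'a :: {field, finite} poly \<Rightarrow> 'a poly"
  where "minus_const f = f - [:poly f 0:]"

definition F_set :: "'a :: {field, finite} poly set \<Rightarrow> bool"
  where "F_set A \<longleftrightarrow> A \<subseteq> monic_irreducibles \<and>
    (\<forall>f\<in>A. \<forall>p\<in>monic_irreducibles. p dvd minus_const f \<longrightarrow> p \<in> A)"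

definition nontrivial_F_set :: "'a :: {field, finite} poly set \<Rightarrow> bool"
  where "nontrivial_F_set A \<longleftrightarrow> F_set A \<and> A \<noteq> monic_irreducibles"

definition nullity :: "'a :: {field, finite} poly set \<Rightarrow> 'a poly set"
  where "nullity A = {f \<in> A. \<forall>g\<in>A. \<not> f dvd minus_const g}"

primrec nullity_filtration :: "'a :: {field, finite} poly set \<Rightarrow> nat \<Rightarrow> 'a poly set"
  where
    "nullity_filtration A 0 = A"
  | "nullity_filtration A (Suc n) = nullity_filtration A n - nullity (nullity_filtration A n)"

definition width :: "'a :: {field, finite} poly set \<Rightarrow> enat"
  where "width A =
    (if \<exists>n. finite (nullity_filtration A n)
     then enat (LEAST n. finite (nullity_filtration A n)) else \<infinity>)"

end

theory Submission
  imports Defs "HOL-Number_Theory.Cong"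
begin

text \<open>
  Let \<open>q = CARD('a)\<close> and write \<open>inflate n P\<close> for \<open>P(X\<^sup>n)\<close>. For \<open>q \<notin> {2, 3}\<close> there is a prime
  \<open>l\<close> dividing \<open>q - 1\<close> such that \<open>4\<close> divides \<open>q - 1\<close> in case \<open>l = 2\<close>. This is what makes the
  tower \<open>Q(X\<^sup>l)\<close>, \<open>Q(X\<^bsup>l\<^sup>2\<^esup>)\<close>, ... over an irreducible polynomial \<open>Q \<noteq> X\<close> of degree \<open>d\<close> easy
  to control: if a root of \<open>Q\<close> is not an \<open>l\<close>-th power in the field with \<open>q ^ d\<close> elements, then
  all polynomials of the tower are irreducible (\<open>nonpower_inflate_power\<close>); otherwise \<open>Q(X\<^sup>l)\<close>
  splits into irreducible factors of the same degree \<open>d\<close> (\<open>degree_factor_inflate_eq\<close>). In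
  either case every irreducible factor of \<open>inflate (l ^ i) Q\<close> has the form \<open>inflate (l ^ t) S\<close>
  with \<open>degree S \<le> degree Q\<close> (\<open>factor_inflate_power_form\<close>).

  Call the least degree of an \<open>R\<close> with \<open>h = inflate (l ^ t) R\<close> the index of \<open>h\<close>. Since \<open>h -
  h(0) = inflate (l ^ t) (R - R(0))\<close> and \<open>R - R(0)\<close> is divisible by \<open>X\<close>, the irreducible
  divisors \<open>g \<noteq> X\<close> of \<open>h - h(0)\<close> have strictly smaller index. So the irreducible polynomials
  of index at most \<open>D\<close>, together with \<open>X\<close>, form an F-set, and its nullity filtration becomes
  finite after at most \<open>D\<close> steps (\<open>F_set_bounded_index\<close>, \<open>finite_filtration_bounded_index\<close>).
  All members of a nullity filtration are F-sets, and dropping the first \<open>m\<close> of them lowers a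
  finite width by \<open>m\<close>; hence an F-set of finite width at least \<open>r\<close> contains one of width
  exactly \<open>r\<close> (\<open>F_set_of_width_exists\<close>).

  It remains to see that the widths of these F-sets are unbounded. The \<open>n\<close>-th member of the
  filtration contains the ends of all descents of length \<open>n\<close> within the F-set, that is, of
  chains in which each polynomial divides its predecessor minus its constant term. Call \<open>Q\<close>
  \<open>n\<close>-deep if such descents from irreducible factors of its tower have ends of arbitrarily large degree. An
  \<open>n\<close>-deep \<open>Q\<close> makes the \<open>n\<close>-th member infinite for \<open>D = degree Q\<close>, so it suffices that
  \<open>n\<close>-deep irreducible polynomials exist for all \<open>n\<close>. This is a counting argument. Call a set
  \<open>S\<close> of polynomials sparse if the sums of \<open>x ^ degree f\<close> over \<open>f \<in> S\<close> converge for all \<open>0 < x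
  < 1\<close>.
  \<^item> The set of monic products of elements of a sparse set is sparse, by comparison with an
    Euler product (\<open>sparse_monic_products\<close>). The set of all monic irreducible polynomials is
    therefore not sparse, as there are \<open>q ^ m\<close> monic polynomials of degree \<open>m\<close>.
  \<^item> The set of the irreducible polynomials that are not \<open>n\<close>-deep is sparse, by induction on
    \<open>n\<close> (\<open>sparse_not_deep\<close>). If the root of \<open>S\<close> is not an \<open>l\<close>-th power and \<open>S\<close> is not \<open>Suc
    n\<close>-deep, then no irreducible factor of \<open>S - S(0)\<close> is \<open>n\<close>-deep, and \<open>S\<close> is determined by
    \<open>S(0)\<close> and a product of such factors. An arbitrary \<open>Q \<noteq> X\<close> is reduced to this case by a
    factor \<open>S\<close> of some \<open>inflate (l ^ s) Q\<close> that has the same degree and whose root is not an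
    \<open>l\<close>-th power (\<open>nonpower_core_exists\<close>).
\<close>

section \<open>Substituting powers of the variable\<close>

abbreviation inflate :: "nat \<Rightarrow> 'a :: comm_semiring_1 poly \<Rightarrow> 'a poly"
  where "inflate n P \<equiv> pcompose P (monom 1 n)"

lemma inflate_1 [simp]: "inflate (Suc 0) P = P"
  by (simp add: monom_Suc monom_0)

lemma inflate_monom: "inflate n (monom c m) = monom c (n * m)" for c :: "'a :: field"
proof (induction m)
  case (Suc m)
  then show ?case by (simp add: monom_Suc[of _ m] pcompose_pCons mult_monom)
qed (simp add: monom_0)

lemma inflate_inflate: "inflate m (inflate n P) = inflate (m * n) P" for P :: "'a :: field poly"
  by (simp add: inflate_monom flip: pcompose_assoc)

lemma degree_inflate: "degree (inflate n P) = n * degree P" for P :: "'a :: field poly"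
  by (simp add: degree_pcompose degree_monom_eq)

lemma lead_coeff_inflate: "n > 0 \<Longrightarrow> lead_coeff (inflate n P) = lead_coeff P" for P :: "'a :: field poly"
  by (subst lead_coeff_comp) (simp_all add: degree_monom_eq)

lemma dvd_inflate: "P dvd R \<Longrightarrow> inflate n P dvd inflate n R" for P :: "'a :: field poly"
  by (auto elim!: dvdE simp: pcompose_mult)

lemma inflate_monom_diff: "inflate n (monom 1 m - 1) = monom 1 (n * m) - (1 :: 'a :: field poly)"
  by (simp add: pcompose_diff inflate_monom pcompose_1)

text \<open>
  A nonzero combination \<open>u * Q + v * P\<close> of least degree divides both \<open>Q\<close> and \<open>P\<close>, hence is a unit.
\<close>
lemma irreducible_bezout:
  fixes Q P :: "'a :: field poly"
  assumes "irreducible Q" "\<not> Q dvd P"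
  obtains u v where "u * Q + v * P = 1"
proof -
  define J where "J = {m. m \<noteq> 0 \<and> (\<exists>u v. m = u * Q + v * P)}"
  have "Q = 1 * Q + 0 * P" "Q \<noteq> 0" using assms(1) by auto
  then have "Q \<in> J" unfolding J_def by blast
  then obtain m where m: "m \<in> J" and mn: "\<And>y. y \<in> J \<Longrightarrow> degree m \<le> degree y"
    using arg_min_natI[of "\<lambda>x. x \<in> J" Q degree] arg_min_nat_le[of "\<lambda>x. x \<in> J" _ degree] by blast
  obtain u v where uv: "m = u * Q + v * P" and m0: "m \<noteq> 0" using m unfolding J_def by blast
  have dv: "m dvd a * Q + b * P" for a b
  proof (rule ccontr)
    assume n: "\<not> m dvd a * Q + b * P"
    let ?r = "(a * Q + b * P) mod m"
    have "?r \<noteq> 0" using n by (simp add: dvd_eq_mod_eq_0)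
    moreover have "?r = (a - (a * Q + b * P) div m * u) * Q + (b - (a * Q + b * P) div m * v) * P"
      using uv by (simp add: algebra_simps minus_div_mult_eq_mod [symmetric])
    ultimately have "?r \<in> J" unfolding J_def by blast
    then show False using mn[of ?r] degree_mod_less'[OF m0 \<open>?r \<noteq> 0\<close>] by simp
  qed
  have "m dvd Q" "m dvd P" using dv[of 1 0] dv[of 0 1] by simp_all
  then have "is_unit m" using assms by (metis dvd_trans irreducibleD')
  then obtain w where "1 = m * w" by (elim dvdE)
  then have "(w * u) * Q + (w * v) * P = 1" using uv by (simp add: algebra_simps)
  then show thesis by (rule that)
qed

text \<open>
  The substitution of \<open>X\<^sup>n\<close> for \<open>X\<close> preserves Bezout relations, so coprime polynomials stay coprime.
  This is how divisibility statements about a factor \<open>g\<close> of \<open>Q(X\<^sup>n)\<close> are brought down to \<open>Q\<close>: in terms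
  of roots, \<open>\<beta>\<^sup>n = \<alpha>\<close> with \<open>g(\<beta>) = 0\<close> and \<open>Q(\<alpha>) = 0\<close>, and \<open>P(\<beta>\<^sup>n) = 0\<close> says \<open>P(\<alpha>) = 0\<close>.
\<close>
lemma dvd_if_inflations_share_factor:
  fixes Q P g :: "'a :: field poly"
  assumes "irreducible Q" "\<not> is_unit g" "g dvd inflate n Q" "g dvd inflate n P"
  shows "Q dvd P"
proof (rule ccontr)
  assume "\<not> Q dvd P"
  with assms(1) obtain u v where "u * Q + v * P = 1" by (rule irreducible_bezout)
  then have "inflate n u * inflate n Q + inflate n v * inflate n P = 1"
    by (metis pcompose_1 pcompose_add pcompose_mult)
  then have "g dvd 1" using assms(3,4) by (metis dvd_add dvd_mult)
  with assms(2) show False by simp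
qed

lemma unit_iff_degree_0: "P \<noteq> 0 \<Longrightarrow> is_unit P \<longleftrightarrow> degree P = 0" for P :: "'a :: field poly"
  using is_unit_iff_degree by blast

lemma monic_irreducible_dvd_exists:
  fixes P :: "'a :: {field, finite} poly"
  assumes "degree P > 0"
  obtains p where "p \<in> monic_irreducibles" "p dvd P"
proof -
  have "\<exists>p \<in> monic_irreducibles. p dvd P"
    using assms
  proof (induction "degree P" arbitrary: P rule: less_induct)
    case less
    show ?case
    proof (cases "irreducible P")
      case True
      let ?c = "inverse (lead_coeff P)"
      have c: "?c \<noteq> 0" using less.prems by auto
      have "irreducible (smult ?c P)" using irreducible_mult_unit_left[of "[:?c:]" P] True c
        by (simp add: is_unit_pCons_iff dvd_field_iff)
      then have "smult ?c P \<in> monic_irreducibles"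
        using less.prems c by (auto simp: monic_irreducibles_def)
      moreover have "smult ?c P dvd P" using c by (simp add: smult_dvd)
      ultimately show ?thesis by blast
    next
      case False
      have P0: "P \<noteq> 0" using less.prems by auto
      have "\<not> is_unit P" using less.prems P0 by (simp add: unit_iff_degree_0)
      then obtain a b where ab: "P = a * b" "\<not> is_unit a" "\<not> is_unit b"
        using False P0 unfolding irreducible_def by auto
      have "a \<noteq> 0" "b \<noteq> 0" using ab P0 by auto
      then have "degree a > 0" "degree a < degree P"
        using ab unit_iff_degree_0[of a] unit_iff_degree_0[of b] by (auto simp: degree_mult_eq)
      from less.hyps[OF this(2,1)] show ?thesis using ab by (meson dvd_mult2)
    qed
  qed
  then show thesis using that by blast
qed

lemma monic_irreducible_prime: "p \<in> monic_irreducibles \<Longrightarrow> prime_elem p"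
  by (simp add: monic_irreducibles_def field_poly_irreducible_imp_prime)

lemma monic_irreducible_not_unit: "p \<in> monic_irreducibles \<Longrightarrow> \<not> is_unit p"
  by (auto simp: monic_irreducibles_def irreducible_def)

lemma monic_irreducible_dvd_eq:
  assumes "p \<in> monic_irreducibles" "f \<in> monic_irreducibles" "p dvd f"
  shows "p = f"
proof -
  obtain c where c: "f = p * c" using assms(3) by (elim dvdE)
  have "is_unit c" using assms c monic_irreducible_not_unit[of p]
    by (auto simp: monic_irreducibles_def dest: irreducibleD)
  then obtain d where d: "c = [:d:]" by (auto elim: is_unit_polyE)
  have "lead_coeff c = 1" using assms c by (auto simp: monic_irreducibles_def lead_coeff_mult)
  then show ?thesis using c d by (auto simp: pCons_one)
qed

lemma factor_of_inflation:
  fixes P g :: "'a :: {field, finite} poly"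
  assumes "prime_elem g" "P \<noteq> 0" "g dvd inflate n P"
  obtains p where "p \<in> monic_irreducibles" "p dvd P" "g dvd inflate n p"
proof -
  have "\<exists>p \<in> monic_irreducibles. p dvd P \<and> g dvd inflate n p"
    using assms(2,3)
  proof (induction "degree P" arbitrary: P rule: less_induct)
    case less
    have "degree P > 0"
    proof (rule ccontr)
      assume "\<not> degree P > 0"
      then obtain c where "P = [:c:]" by (metis degree_eq_zeroE gr0I)
      with less.prems assms(1) show False
        by (auto simp: prime_elem_def) (metis dvd_field_iff dvd_trans is_unit_pCons_iff)
    qed
    then obtain p where p: "p \<in> monic_irreducibles" "p dvd P" by (rule monic_irreducible_dvd_exists)
    then obtain R where R: "P = p * R" by (elim dvdE)
    have "g dvd inflate n p * inflate n R" using less.prems R by (simp add: pcompose_mult)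
    then consider "g dvd inflate n p" | "g dvd inflate n R"
      using assms(1) prime_elem_dvd_mult_iff by blast
    then show ?case
    proof cases
      case 1 then show ?thesis using p by blast
    next
      case 2
      have "R \<noteq> 0" "degree R < degree P" using R less.prems p
        by (auto simp: degree_mult_eq monic_irreducibles_def)
      with less.hyps[OF this(2,1) 2] R show ?thesis by (meson dvd_mult)
    qed
  qed
  then show thesis using that by blast
qed

section \<open>The Frobenius map on polynomials over a finite field\<close>

lemma CARD_field_ge_2: "CARD('a :: {field, finite}) \<ge> 2"
proof -
  have "card {0, 1 :: 'a} \<le> CARD('a)" by (rule card_mono) auto
  then show ?thesis by simp
qed

lemma power_CARD [simp]: "(x :: 'a :: {field, finite}) ^ CARD('a) = x"
proof (cases "x = 0")
  case False
  have "(\<Prod>y\<in>UNIV-{0}. x * y) = (\<Prod>y\<in>UNIV-{0}. y)"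
    by (rule prod.reindex_bij_witness[of _ "\<lambda>y. y / x" "\<lambda>y. x * y"]) (use False in auto)
  then have "x ^ (CARD('a) - 1) * \<Prod>(UNIV - {0::'a}) = 1 * \<Prod>(UNIV - {0::'a})"
    by (simp add: prod.distrib card_Diff_singleton)
  then have "x ^ (CARD('a) - 1) = 1"
    by (subst (asm) mult_right_cancel) auto
  moreover have "CARD('a) = Suc (CARD('a) - 1)" using CARD_field_ge_2[where 'a='a] by simp
  ultimately show ?thesis by (metis mult_1_right power_Suc)
qed (use CARD_field_ge_2[where 'a='a] in auto)

text \<open>
  Every element \<open>x\<close> satisfies \<open>(x + 1) ^ q = x + 1 = x ^ q + 1\<close>. The difference of the outer terms is
  a polynomial in \<open>x\<close> of degree less than \<open>q\<close> that vanishes at all \<open>q\<close> elements, so its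
  coefficients are zero. This gives additivity of the \<open>q\<close>-th power without writing \<open>q\<close> as
  a power of the characteristic.
\<close>
lemma of_nat_CARD_choose_eq_0:
  assumes "0 < i" "i < CARD('a)"
  shows "of_nat (CARD('a) choose i) = (0 :: 'a :: {field, finite})"
proof -
  let ?q = "CARD('a)"
  define R :: "'a poly" where "R = (\<Sum>j\<in>{1..<?q}. monom (of_nat (?q choose j)) j)"
  have ev: "poly R x = 0" for x
  proof -
    have "x + 1 = (x + 1) ^ ?q" by (rule power_CARD[symmetric])
    also have "\<dots> = (\<Sum>j\<le>?q. of_nat (?q choose j) * x ^ j)"
      unfolding binomial_ring by simp
    also have "{..?q} = insert 0 (insert ?q {1..<?q})" using CARD_field_ge_2[where 'a='a] by auto
    also have "(\<Sum>j\<in>insert 0 (insert ?q {1..<?q}). of_nat (?q choose j) * x ^ j) = 1 + (x + poly R x)"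
      using CARD_field_ge_2[where 'a='a] by (simp add: R_def poly_sum poly_monom)
    finally show ?thesis by simp
  qed
  have "R = 0"
  proof (rule ccontr)
    assume R: "R \<noteq> 0"
    have "degree R \<le> ?q - 1" unfolding R_def
      by (rule degree_sum_le) (auto intro: order.trans[OF degree_monom_le])
    moreover have "card {x. poly R x = 0} \<le> degree R" by (rule card_poly_roots_bound[OF R])
    ultimately show False using ev CARD_field_ge_2[where 'a='a] by simp
  qed
  then have "coeff R i = 0" by simp
  then show ?thesis using assms by (simp add: R_def coeff_sum)
qed

lemma add_power_CARD_poly:
  fixes u v :: "'a :: {field, finite} poly"
  shows "(u + v) ^ CARD('a) = u ^ CARD('a) + v ^ CARD('a)"
proof -
  let ?q = "CARD('a)"
  have "(u + v) ^ ?q = (\<Sum>j\<le>?q. of_nat (?q choose j) * u ^ j * v ^ (?q - j))"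
    by (simp add: binomial_ring)
  also have "\<dots> = (\<Sum>j\<in>{0, ?q}. of_nat (?q choose j) * u ^ j * v ^ (?q - j))"
  proof (rule sum.mono_neutral_right)
    show "\<forall>j\<in>{..?q} - {0, ?q}. of_nat (?q choose j) * u ^ j * v ^ (?q - j) = 0"
      using of_nat_CARD_choose_eq_0[where 'a='a] by (auto simp: of_nat_poly)
  qed auto
  also have "\<dots> = u ^ ?q + v ^ ?q" using CARD_field_ge_2[where 'a='a] by simp
  finally show ?thesis .
qed

lemma poly_power_CARD:
  fixes u :: "'a :: {field, finite} poly"
  shows "u ^ CARD('a) = inflate (CARD('a)) u"
proof (induction u)
  case (pCons a p)
  have "pCons a p ^ CARD('a) = ([:a:] + monom 1 1 * p) ^ CARD('a)"
    by (simp add: monom_Suc monom_0)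
  also have "\<dots> = [:a:] + monom 1 (CARD('a)) * inflate (CARD('a)) p"
    using pCons.IH by (simp add: add_power_CARD_poly power_mult_distrib monom_power poly_const_pow)
  finally show ?case by (simp add: pcompose_pCons)
qed (use CARD_field_ge_2[where 'a='a] in simp)

lemma poly_power_CARD_power:
  fixes u :: "'a :: {field, finite} poly"
  shows "u ^ (CARD('a) ^ n) = inflate (CARD('a) ^ n) u"
proof (induction n)
  case (Suc n)
  have "u ^ (CARD('a) ^ Suc n) = (u ^ (CARD('a) ^ n)) ^ CARD('a)"
    by (simp flip: power_mult add: mult.commute)
  then show ?case using Suc by (simp add: poly_power_CARD inflate_inflate)
qed simp

section \<open>Residues modulo an irreducible polynomial\<close>

lemma card_small_polys:
  "finite {p :: 'a :: {field, finite} poly. p = 0 \<or> degree p < n} \<and>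
   card {p :: 'a poly. p = 0 \<or> degree p < n} = CARD('a) ^ n"
proof (induction n)
  case (Suc n)
  let ?P = "{p :: 'a poly. p = 0 \<or> degree p < n}"
  have "{p :: 'a poly. p = 0 \<or> degree p < Suc n} = (\<lambda>(a, p). pCons a p) ` (UNIV \<times> ?P)" (is "?L = ?R")
  proof (rule set_eqI)
    fix x :: "'a poly"
    obtain a p where x: "x = pCons a p" by (rule pCons_cases)
    have "x \<in> ?R \<longleftrightarrow> p \<in> ?P" using x by auto
    also have "\<dots> \<longleftrightarrow> x \<in> ?L" using x by (auto simp: degree_pCons_eq_if split: if_splits)
    finally show "x \<in> ?L \<longleftrightarrow> x \<in> ?R" by simp
  qed
  moreover have "inj_on (\<lambda>(a, p). pCons a p) (UNIV \<times> ?P)" by (auto simp: inj_on_def)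
  ultimately show ?case using Suc by (simp add: card_image card_cartesian_product)
qed simp

text \<open>
  The usual bound on the number of roots in an integral domain, with the domain presented as
  residues modulo a prime element instead of a quotient type.
\<close>
lemma card_roots_mod_prime_elem_le:
  fixes Q :: "'b :: idom"
  assumes "prime_elem Q" "lead_coeff H = 1" "finite A"
    and "\<And>a. a \<in> A \<Longrightarrow> Q dvd poly H a"
    and "\<And>a b. a \<in> A \<Longrightarrow> b \<in> A \<Longrightarrow> Q dvd a - b \<Longrightarrow> a = b"
  shows "card A \<le> degree H"
  using assms(2-)
proof (induction "degree H" arbitrary: H A)
  case 0
  then have "H = 1" by (metis lead_coeff_pCons(2) degree_eq_zeroE one_poly_eq_simps(1) coeff_pCons_0)
  then have "A = {}" using 0 assms(1) by (auto simp: prime_elem_def)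
  then show ?case by simp
next
  case (Suc m)
  show ?case
  proof (cases "A = {}")
    case False
    then obtain a where a: "a \<in> A" by blast
    define K where "K = synthetic_div H a"
    have H: "H = [:- a, 1:] * K + [:poly H a:]" using synthetic_div_correct'[of a H] by (simp add: K_def)
    have dK: "degree K = m" using Suc(2) by (simp add: K_def degree_synthetic_div)
    have K0: "K \<noteq> 0" using Suc(2) by (auto simp: K_def synthetic_div_eq_0_iff)
    have "lead_coeff K = 1"
    proof -
      have "degree ([:- a, 1:] * K) = Suc m" using K0 dK by (subst degree_mult_eq) auto
      then have "lead_coeff H = lead_coeff ([:- a, 1:] * K)"
        using H by (metis degree_pCons_0 degree_add_eq_left zero_less_Suc coeff_add coeff_eq_0 add.right_neutral)
      then show ?thesis using Suc.prems(1) unfolding lead_coeff_mult by simp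
    qed
    moreover have "Q dvd poly K b" if b: "b \<in> A - {a}" for b
    proof -
      have "poly H b = (b - a) * poly K b + poly H a"
        by (subst H) (simp add: algebra_simps)
      moreover have "Q dvd poly H b" "Q dvd poly H a" using b a Suc.prems by auto
      ultimately have "Q dvd (b - a) * poly K b" by (metis dvd_add_left_iff)
      moreover have "\<not> Q dvd b - a" using Suc.prems(4) b a by blast
      ultimately show ?thesis using assms(1) by (simp add: prime_elem_dvd_mult_iff)
    qed
    ultimately have "card (A - {a}) \<le> degree K"
      using Suc.prems(2,4) dK by (intro Suc.hyps(1)) auto
    then show ?thesis using dK Suc(2) a Suc.prems(2) by (simp add: card_Diff_singleton)
  qed simp
qed

text \<open>
  If the \<open>n\<close>-th power of Frobenius fixes the residue of \<open>X\<close>, it fixes every residue, because it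
  is given by \<open>u(X) \<mapsto> u(X ^ (q ^ n))\<close>.
\<close>
lemma X_pow_dvd_power_diff:
  fixes Q u :: "'a :: {field, finite} poly"
  assumes "Q dvd monom 1 (CARD('a) ^ n) - monom 1 1"
  shows "Q dvd u ^ (CARD('a) ^ n) - u"
proof -
  have "monom 1 (CARD('a) ^ n) - monom 1 1 dvd inflate (CARD('a) ^ n) u - u"
  proof (induction u)
    case (pCons a p)
    let ?N = "CARD('a) ^ n"
    have "inflate ?N (pCons a p) - pCons a p =
      monom 1 ?N * (inflate ?N p - p) + (monom 1 ?N - monom 1 1) * p"
      by (simp add: pcompose_pCons algebra_simps monom_Suc monom_0)
    then show ?case using pCons.IH by simp
  qed simp
  then show ?thesis using assms unfolding poly_power_CARD_power by (rule dvd_trans[rotated])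
qed

text \<open>
  All \<open>q ^ degree Q\<close> residues modulo \<open>Q\<close> are roots of \<open>Y ^ (q ^ n) - Y\<close>.
\<close>
lemma degree_le_of_dvd_X_pow:
  fixes Q :: "'a :: {field, finite} poly"
  assumes "Q \<in> monic_irreducibles" "n > 0" "Q dvd monom 1 (CARD('a) ^ n) - monom 1 1"
  shows "degree Q \<le> n"
proof -
  let ?N = "CARD('a) ^ n"
  let ?A = "{p :: 'a poly. p = 0 \<or> degree p < degree Q}"
  define H :: "'a poly poly" where "H = monom 1 ?N - monom 1 1"
  have N: "?N > 1" using CARD_field_ge_2[where 'a='a] assms(2) by (metis one_less_power One_nat_def Suc_1 Suc_le_lessD)
  have dH: "degree H = ?N" unfolding H_def
    by (rule antisym, rule degree_diff_le) (use N in \<open>auto simp: degree_monom_eq intro!: le_degree\<close>)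
  have "card ?A \<le> degree H"
  proof (rule card_roots_mod_prime_elem_le[OF monic_irreducible_prime[OF assms(1)]])
    show "lead_coeff H = 1" unfolding dH using N by (simp add: H_def)
    show "finite ?A" using card_small_polys by blast
    show "Q dvd poly H a" for a
      using X_pow_dvd_power_diff[OF assms(3), of a] by (simp add: H_def poly_monom)
    fix a b :: "'a poly" assume ab: "a \<in> ?A" "b \<in> ?A" "Q dvd a - b"
    have "degree (a - b) < degree Q \<or> a - b = 0"
      using ab(1,2) assms(1) by (auto intro: degree_diff_less)
    with ab(3) show "a = b" using dvd_imp_degree_le[of Q "a - b"] by fastforce
  qed
  then have "CARD('a) ^ degree Q \<le> CARD('a) ^ n" using card_small_polys[where 'a='a, of "degree Q"] dH by simp
  then show ?thesis using CARD_field_ge_2[where 'a='a] by (subst (asm) power_increasing_iff) auto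
qed

abbreviation X where "X \<equiv> monom 1 (Suc 0)"

lemma X_monic_irreducible: "X \<in> monic_irreducibles"
  using irreducible_linear_field_poly[of 1 0]
  by (auto simp: monic_irreducibles_def degree_monom_eq monom_Suc monom_0)

lemma not_dvd_X: "Q \<in> monic_irreducibles \<Longrightarrow> Q \<noteq> X \<Longrightarrow> \<not> Q dvd X"
  using monic_irreducible_dvd_eq[OF _ X_monic_irreducible] by metis

text \<open>
  Multiplication by \<open>X\<close> permutes the nonzero residues modulo \<open>Q\<close>; comparing the products of all of
  them before and after yields the claim, as in the proof of Fermat's little theorem.
\<close>
lemma fermat_mod_irreducible:
  fixes Q :: "'a :: {field, finite} poly"
  assumes "Q \<in> monic_irreducibles" "Q \<noteq> X"
  shows "Q dvd monom 1 (CARD('a) ^ degree Q - 1) - 1"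
proof -
  let ?B = "{p :: 'a poly. p = 0 \<or> degree p < degree Q}"
  define A where "A = ?B - {0}"
  have fin: "finite A" and card: "card A = CARD('a) ^ degree Q - 1"
    using card_small_polys[where 'a='a, of "degree Q"] by (simp_all add: A_def card_Diff_singleton)
  have Q: "prime_elem Q" "Q \<noteq> 0" using assms(1) monic_irreducible_prime by (auto simp: monic_irreducibles_def)
  have nd: "\<not> Q dvd u" if "u \<in> A" for u
    using that dvd_imp_degree_le[of Q u] by (auto simp: A_def)
  define \<phi> where "\<phi> u = (X * u) mod Q" for u :: "'a poly"
  have "\<phi> u \<in> A" if "u \<in> A" for u
  proof -
    have "\<not> Q dvd X * u" using nd[OF that] not_dvd_X[OF assms] Q by (simp add: prime_elem_dvd_mult_iff)
    then have "\<phi> u \<noteq> 0" by (simp add: \<phi>_def dvd_eq_mod_eq_0)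
    then show ?thesis using degree_mod_less'[OF Q(2)] by (auto simp: A_def \<phi>_def)
  qed
  moreover have inj: "inj_on \<phi> A"
  proof (rule inj_onI)
    fix u v assume uv: "u \<in> A" "v \<in> A" "\<phi> u = \<phi> v"
    then have "Q dvd X * (u - v)"
      unfolding \<phi>_def by (simp add: mod_eq_dvd_iff right_diff_distrib)
    then have "Q dvd u - v" using not_dvd_X[OF assms] Q by (simp add: prime_elem_dvd_mult_iff)
    moreover have "u - v = 0 \<or> u - v \<in> A" using uv by (auto simp: A_def intro: degree_diff_less)
    ultimately show "u = v" using nd by auto
  qed
  ultimately have "\<phi> ` A = A" using fin by (intro endo_inj_surj) auto
  then have "(\<Prod>u\<in>A. \<phi> u) = \<Prod>A"
    using prod.reindex[OF inj, of "\<lambda>x. x"] by simp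
  then have "[(\<Prod>u\<in>A. X * u) = \<Prod>A] (mod Q)"
    unfolding cong_def \<phi>_def by (metis mod_prod_eq)
  then have "Q dvd X ^ card A * \<Prod>A - \<Prod>A"
    by (simp add: cong_iff_dvd_diff prod.distrib)
  also have "X ^ card A * \<Prod>A - \<Prod>A = (X ^ card A - 1) * \<Prod>A" by (simp add: algebra_simps)
  finally have "Q dvd (X ^ card A - 1) * \<Prod>A" .
  moreover have "\<not> Q dvd \<Prod>A"
    using fin nd
    by (induction A rule: finite_induct)
       (simp_all add: prime_elem_dvd_mult_iff[OF Q(1)] prime_elem_not_unit[OF Q(1)])
  ultimately have "Q dvd X ^ card A - 1" using Q(1) by (simp add: prime_elem_dvd_mult_iff)
  then show ?thesis by (simp add: monom_power card)
qed

lemma dvd_X_pow_card_diff: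
  fixes Q :: "'a :: {field, finite} poly"
  assumes "Q \<in> monic_irreducibles"
  shows "Q dvd monom 1 (CARD('a) ^ degree Q) - X"
proof (cases "Q = X")
  case True
  then show ?thesis using CARD_field_ge_2[where 'a='a]
    by (simp add: degree_monom_eq monom_1_dvd_iff')
next
  case False
  have "monom 1 (CARD('a) ^ degree Q) - X = X * (monom 1 (CARD('a) ^ degree Q - 1) - 1 :: 'a poly)"
    using CARD_field_ge_2[where 'a='a] by (simp add: right_diff_distrib mult_monom)
  then show ?thesis using fermat_mod_irreducible[OF assms False] by simp
qed

text \<open>
  By reduction of \<open>n\<close> modulo \<open>d = degree Q\<close>: the \<open>d\<close>-th power of Frobenius is trivial modulo \<open>Q\<close>,
  and no smaller positive power fixes \<open>X\<close>.
\<close>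
lemma degree_dvd_of_dvd_X_pow:
  fixes Q :: "'a :: {field, finite} poly"
  assumes Q: "Q \<in> monic_irreducibles" and n: "Q dvd monom 1 (CARD('a) ^ n) - X"
  shows "degree Q dvd n"
proof -
  let ?d = "degree Q" and ?q = "CARD('a)"
  have add: "[monom 1 (?q ^ (a + b)) = monom 1 (?q ^ b)] (mod Q)"
    if "[monom 1 (?q ^ a) = X] (mod Q)" for a b
    using cong_pow[OF that, of "?q ^ b"] by (simp add: monom_power power_add)
  have base: "[monom 1 (?q ^ ?d) = X] (mod Q)"
    using dvd_X_pow_card_diff[OF Q] by (simp add: cong_iff_dvd_diff)
  have mult: "[monom 1 (?q ^ (?d * k)) = X] (mod Q)" for k
  proof (induction k)
    case (Suc k)
    show ?case using cong_trans[OF add[OF base, of "?d * k"] Suc] by (simp add: add.commute)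
  qed simp
  have "[monom 1 (?q ^ n) = X] (mod Q)" using n by (simp add: cong_iff_dvd_diff)
  then have "[monom 1 (?q ^ (n mod ?d)) = X] (mod Q)"
    using add[OF mult[of "n div ?d"], of "n mod ?d"] by (metis cong_sym cong_trans mult_div_mod_eq)
  then have "Q dvd monom 1 (?q ^ (n mod ?d)) - monom 1 1" by (simp add: cong_iff_dvd_diff)
  with Q have "n mod ?d > 0 \<Longrightarrow> ?d \<le> n mod ?d" by (intro degree_le_of_dvd_X_pow) auto
  moreover have "?d > 0" using Q by (simp add: monic_irreducibles_def)
  ultimately show ?thesis by (meson dvd_eq_mod_eq_0 gr0I leD mod_less_divisor)
qed

text \<open>
  A root of \<open>g\<close> generates a field that contains its \<open>n\<close>-th power, which is a root of \<open>Q\<close>.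
\<close>
lemma degree_dvd_degree_factor_inflate:
  fixes Q g :: "'a :: {field, finite} poly"
  assumes "Q \<in> monic_irreducibles" "g \<in> monic_irreducibles" "g dvd inflate n Q"
  shows "degree Q dvd degree g"
proof (rule degree_dvd_of_dvd_X_pow[OF assms(1)])
  let ?N = "CARD('a) ^ degree g"
  have "g dvd monom 1 n ^ ?N - monom 1 n"
    using dvd_X_pow_card_diff[OF assms(2)] by (intro X_pow_dvd_power_diff) simp
  then have "g dvd inflate n (monom 1 ?N - X)"
    by (simp add: pcompose_diff inflate_monom monom_power)
  then show "Q dvd monom 1 ?N - X"
    using assms monic_irreducible_not_unit
    by (intro dvd_if_inflations_share_factor[of Q g n]) (auto simp: monic_irreducibles_def)
qed

lemma factor_inflate_neq_X:
  assumes "Q \<in> monic_irreducibles" "Q \<noteq> X" "n > 0" "g dvd inflate n Q"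
  shows "g \<noteq> X"
proof
  assume "g = X"
  then have "g dvd inflate n X" using assms(3) by (simp add: inflate_monom monom_1_dvd_iff')
  then have "Q dvd X" using assms \<open>g = X\<close> monic_irreducible_not_unit[OF X_monic_irreducible]
    by (intro dvd_if_inflations_share_factor[of Q g n]) (auto simp: monic_irreducibles_def)
  with not_dvd_X assms show False by blast
qed

section \<open>Exponents and geometric sums\<close>

lemma cong_power_gcd_1:
  fixes x Q :: "'b :: unique_euclidean_ring"
  assumes "[x ^ a = 1] (mod Q)" "[x ^ b = 1] (mod Q)"
  shows "[x ^ gcd a b = 1] (mod Q)"
  using assms
proof (induction a b rule: gcd_nat_induct)
  case (step m n)
  have "[x ^ m = (x ^ n) ^ (m div n) * x ^ (m mod n)] (mod Q)"
    by (simp flip: power_mult power_add)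
  also have "[(x ^ n) ^ (m div n) * x ^ (m mod n) = 1 ^ (m div n) * x ^ (m mod n)] (mod Q)"
    by (intro cong_mult cong_pow step.prems cong_refl)
  finally have "[x ^ (m mod n) = 1] (mod Q)" using step.prems by (metis cong_sym cong_trans mult_1 power_one)
  then show ?case using step.IH step.prems by (simp add: gcd_red_nat[of m n])
qed simp

lemma dvd_X_pow_gcd:
  fixes Q :: "'a :: field poly"
  assumes "Q dvd monom 1 a - 1" "Q dvd monom 1 b - 1"
  shows "Q dvd monom 1 (gcd a b) - 1"
  using cong_power_gcd_1[of X a Q b] assms by (simp add: cong_iff_dvd_diff monom_power)

lemma geometric_sum_factor: "(z::nat) ^ k - 1 = (z - 1) * (\<Sum>i<k. z ^ i)"
proof (cases "z = 0")
  case False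
  have "int (z ^ k) - 1 = (int z - 1) * (\<Sum>i<k. int z ^ i)"
    using power_diff_1_eq[of "int z" k] by simp
  then have "int (z ^ k - 1) = int ((z - 1) * (\<Sum>i<k. z ^ i))" using False by (simp add: of_nat_diff)
  then show ?thesis by (simp only: of_nat_eq_iff)
qed (cases k; simp)

lemma geometric_sum_cong:
  fixes z l :: nat
  assumes "[z = 1] (mod l)"
  shows "[(\<Sum>i<k. z ^ i) = k] (mod l)"
proof -
  have "[(\<Sum>i<k. z ^ i) = (\<Sum>i<k. 1 ^ i)] (mod l)" by (intro cong_sum cong_pow assms)
  then show ?thesis by simp
qed

text \<open>
  Writing \<open>z = 1 + l * y\<close>, the sum is \<open>l + l * y * (l * (l - 1) / 2)\<close> modulo \<open>l\<^sup>2\<close>. The second term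
  vanishes modulo \<open>l\<^sup>2\<close> if \<open>l\<close> is odd, and also for \<open>l = 2\<close> if \<open>y\<close> is even; the latter is what the
  congruence modulo \<open>4\<close> is for.
\<close>
lemma not_square_dvd_geometric_sum:
  fixes z l :: nat
  assumes "prime l" "[z = 1] (mod l)" "l = 2 \<Longrightarrow> [z = 1] (mod 4)" "z > 0"
  shows "\<not> l\<^sup>2 dvd (\<Sum>i<l. z ^ i)"
proof
  assume dv: "l\<^sup>2 dvd (\<Sum>i<l. z ^ i)"
  obtain y where y: "z = 1 + l * y"
    using assms(2,4) by (metis One_nat_def Suc_leI cong_to_1_nat le_add_diff_inverse dvd_def)
  have pw: "[z ^ i = 1 + i * (l * y)] (mod l\<^sup>2)" for i
  proof (induction i)
    case (Suc i)
    have "[z ^ Suc i = (1 + l * y) * (1 + i * (l * y))] (mod l\<^sup>2)"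
      unfolding power_Suc using Suc by (intro cong_mult) (simp_all add: y)
    also have "(1 + l * y) * (1 + i * (l * y)) = 1 + Suc i * (l * y) + l\<^sup>2 * (i * y\<^sup>2)"
      by (simp add: algebra_simps power2_eq_square)
    also have "[\<dots> = 1 + Suc i * (l * y)] (mod l\<^sup>2)" by (simp add: cong_def)
    finally show ?case .
  qed simp
  have dvd_y: "l dvd y * (\<Sum>i<l. i)"
  proof (cases "l = 2")
    case True
    with assms(3,4) have "4 dvd z - 1" by (metis One_nat_def Suc_leI cong_to_1_nat)
    then have "2 dvd y" using True y by presburger
    then show ?thesis using True by simp
  next
    case False
    then have odd: "odd l" using prime_odd_nat[OF assms(1)] prime_ge_2_nat[OF assms(1)] by linarith
    have "2 * (\<Sum>i<k. i) = k * (k - 1)" for k :: nat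
    proof (induction k)
      case (Suc k)
      then show ?case by (cases k) (simp_all add: algebra_simps)
    qed simp
    then have "l dvd 2 * (\<Sum>i<l. i)" by simp
    moreover have "coprime l 2" using odd by simp
    ultimately show ?thesis by (simp add: coprime_dvd_mult_right_iff)
  qed
  have "[(\<Sum>i<l. z ^ i) = (\<Sum>i<l. 1 + i * (l * y))] (mod l\<^sup>2)" by (intro cong_sum pw)
  also have "(\<Sum>i<l. 1 + i * (l * y)) = l + (\<Sum>i<l. i) * (l * y)"
    unfolding sum.distrib sum_distrib_right by simp
  also obtain c where c: "y * (\<Sum>i<l. i) = l * c" using dvd_y by (elim dvdE)
  have "(\<Sum>i<l. i) * (l * y) = l\<^sup>2 * c"
    using c by (metis mult.assoc mult.commute power2_eq_square)
  also have "[l + l\<^sup>2 * c = l] (mod l\<^sup>2)" by (simp add: cong_def)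
  finally have "l\<^sup>2 dvd l" using dv cong_dvd_iff by blast
  then have "l ^ 2 \<le> l ^ 1" using assms(1) by (intro dvd_imp_le) (auto simp: prime_gt_0_nat)
  then show False using prime_gt_1_nat[OF assms(1)] by (subst (asm) power_increasing_iff) auto
qed

text \<open>
  The polynomial is coprime to its derivative, since its exponent is \<open>-1\<close> in the field.
\<close>
lemma not_square_dvd_X_pow_minus_1:
  fixes p :: "'a :: {field, finite} poly"
  assumes "p \<in> monic_irreducibles" "n > 0"
  shows "\<not> p * p dvd monom 1 (CARD('a) ^ n - 1) - 1"
proof
  let ?m = "CARD('a) ^ n - 1"
  assume "p * p dvd monom 1 ?m - 1"
  then obtain c where c: "monom 1 ?m - 1 = p * (p * c)" unfolding dvd_def mult.assoc by blast
  have "(of_nat (CARD('a)) :: 'a) = 0"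
    using of_nat_CARD_choose_eq_0[where 'a='a, of 1] CARD_field_ge_2[where 'a='a] by simp
  then have "(of_nat ?m :: 'a) = -1"
    using assms(2) CARD_field_ge_2[where 'a='a] by (simp add: of_nat_diff zero_power)
  then have "pderiv (monom 1 ?m - 1 :: 'a poly) = - monom 1 (?m - 1)"
    by (simp add: pderiv_diff pderiv_monom minus_monom)
  moreover have "p dvd pderiv (monom 1 ?m - 1)"
    unfolding c by (simp add: pderiv_mult)
  ultimately have "p dvd monom 1 (?m - 1)" by simp
  moreover have "Suc (?m - 1) = ?m" using one_less_power[of "CARD('a)" n] CARD_field_ge_2[where 'a='a] assms(2) by simp
  ultimately have "p dvd monom 1 ?m"
    using dvd_mult[of p "monom 1 (?m - 1)" X] by (simp add: mult_monom del: diff_Suc_1 diff_diff_left)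
  moreover have "p dvd monom 1 ?m - 1" unfolding c by simp
  ultimately have "p dvd monom 1 ?m - (monom 1 ?m - 1)" by (rule dvd_diff)
  then show False using monic_irreducible_not_unit[OF assms(1)] by simp
qed

text \<open>
  For a divisor \<open>F\<close> of a squarefree polynomial, divisibility can be tested on prime factors.
\<close>
lemma dvd_if_prime_factors_dvd:
  fixes F W T :: "'a :: {field, finite} poly"
  assumes "\<And>p. p \<in> monic_irreducibles \<Longrightarrow> \<not> p * p dvd T" "T \<noteq> 0" "F dvd T"
    and "\<And>p. p \<in> monic_irreducibles \<Longrightarrow> p dvd F \<Longrightarrow> p dvd W"
  shows "F dvd W"
  using assms(3,4)
proof (induction "degree F" arbitrary: F rule: less_induct)
  case less
  have F0: "F \<noteq> 0" using less.prems assms(2) by auto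
  show ?case
  proof (cases "degree F = 0")
    case True
    then show ?thesis using F0 unit_iff_degree_0 unit_imp_dvd by blast
  next
    case False
    then obtain p where p: "p \<in> monic_irreducibles" "p dvd F"
      using monic_irreducible_dvd_exists by blast
    then obtain R where R: "F = p * R" by (elim dvdE)
    have "degree R < degree F" using R F0 p by (auto simp: degree_mult_eq monic_irreducibles_def)
    moreover have "R dvd T" using less.prems R by (meson dvd_mult_right)
    ultimately have "R dvd W" using less.prems R less.hyps by (meson dvd_mult)
    then obtain Z where Z: "W = R * Z" by (elim dvdE)
    have "\<not> p dvd R"
    proof
      assume "p dvd R"
      then have "p * p dvd F" using R by (simp add: mult_dvd_mono)
      then show False using assms(1)[OF p(1)] less.prems dvd_trans by blast
    qed
    moreover have "p dvd R * Z" using less.prems p Z by blast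
    ultimately have "p dvd Z" using monic_irreducible_prime[OF p(1)] prime_elem_dvd_mult_iff by blast
    then show ?thesis using R Z by (simp add: mult_dvd_mono mult.commute)
  qed
qed

lemma monic_irreducible_degree_pos: "Q \<in> monic_irreducibles \<Longrightarrow> degree Q > 0"
  by (simp add: monic_irreducibles_def)

lemma dvd_if_inflations_share_monic_irreducible:
  assumes "Q \<in> monic_irreducibles" "g \<in> monic_irreducibles" "g dvd inflate n Q" "g dvd inflate n P"
  shows "Q dvd P"
  using assms monic_irreducible_not_unit
  by (intro dvd_if_inflations_share_factor[of Q g n]) (auto simp: monic_irreducibles_def)

section \<open>Irreducible polynomials whose root is not an \<open>l\<close>-th power\<close>

text \<open>
  The type argument only records which field is meant. The condition modulo \<open>4\<close> is the familiar
  exception in the irreducibility criterion for \<open>X ^ (2 ^ j) - a\<close>: over the field with three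
  elements \<open>X\<^sup>2 + 1\<close> is irreducible, but \<open>X ^ 4 + 1\<close> is not.
\<close>
locale kummer_prime =
  fixes l :: nat and F :: "'a :: {field, finite} itself"
  assumes prime_l: "prime l"
    and card_cong_l: "[CARD('a) = 1] (mod l)"
    and card_cong_4: "l = 2 \<Longrightarrow> [CARD('a) = 1] (mod 4)"
begin

lemma l_pos: "l > 0" and l_ge_2: "l \<ge> 2"
  using prime_l prime_gt_0_nat prime_ge_2_nat by auto

lemma l_dvd: "l dvd CARD('a) ^ d - 1"
  using cong_pow[OF card_cong_l, of d] cong_to_1_nat by simp

lemma power_card_minus_1: "CARD('a) ^ d - 1 = l * ((CARD('a) ^ d - 1) div l)"
  using l_dvd by simp

text \<open>
  The multiplicative group of residues modulo \<open>Q\<close> is cyclic of order \<open>q ^ d - 1\<close>, a multiple of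
  \<open>l\<close>. So the condition says that the residue of \<open>X\<close>, a root of \<open>Q\<close>, is not an \<open>l\<close>-th power.
\<close>
definition nonpower :: "'a poly \<Rightarrow> bool"
  where "nonpower Q \<longleftrightarrow> Q \<in> monic_irreducibles \<and> Q \<noteq> X \<and>
    \<not> Q dvd monom 1 ((CARD('a) ^ degree Q - 1) div l) - 1"

lemma nonpower_not_dvd:
  assumes "nonpower Q" "\<not> l dvd m"
  shows "\<not> Q dvd monom 1 ((CARD('a) ^ degree Q - 1) div l * m) - 1"
proof
  let ?e = "(CARD('a) ^ degree Q - 1) div l"
  assume "Q dvd monom 1 (?e * m) - 1"
  moreover have "Q dvd monom 1 (?e * l) - 1"
    using fermat_mod_irreducible[of Q] assms(1) power_card_minus_1 by (metis mult.commute nonpower_def)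
  ultimately have "Q dvd monom 1 (gcd (?e * m) (?e * l)) - 1" by (rule dvd_X_pow_gcd)
  moreover have "gcd (?e * m) (?e * l) = ?e"
    using prime_imp_coprime[OF prime_l assms(2)] by (simp add: gcd_mult_distrib_nat[symmetric] coprime_iff_gcd_eq_1 gcd.commute)
  ultimately show False using assms(1) by (simp add: nonpower_def)
qed

text \<open>
  Let \<open>g\<close> be an irreducible factor of \<open>Q(X\<^sup>l)\<close>, of degree \<open>d * k\<close>. Its root is an \<open>l\<close>-th root of a root
  of \<open>Q\<close>, so the order of the latter divides \<open>(q ^ (d * k) - 1) / l\<close>. As the \<open>l\<close>-part of that order
  is the full \<open>l\<close>-part of \<open>q ^ d - 1\<close>, the quotient of \<open>q ^ (d * k) - 1\<close> by \<open>q ^ d - 1\<close> is divisible by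
  \<open>l\<close>; since it is congruent to \<open>k\<close>, so is \<open>k\<close>. Thus \<open>g\<close> has the full degree \<open>d * l\<close>. The root of \<open>g\<close>
  is again no \<open>l\<close>-th power because for \<open>k = l\<close> the quotient is divisible by \<open>l\<close> only once.
\<close>
lemma nonpower_inflate:
  assumes "nonpower Q"
  shows "nonpower (inflate l Q)"
proof -
  let ?q = "CARD('a)" and ?d = "degree Q"
  let ?e = "(?q ^ ?d - 1) div l"
  have Q: "Q \<in> monic_irreducibles" "Q \<noteq> X" using assms by (auto simp: nonpower_def)
  have d: "?d > 0" using Q by (simp add: monic_irreducible_degree_pos)
  have z: "[?q ^ ?d = 1] (mod l)" "l = 2 \<Longrightarrow> [?q ^ ?d = 1] (mod 4)" "?q ^ ?d > 0"
    using cong_pow[OF card_cong_l, of ?d] cong_pow[OF card_cong_4, of ?d] by simp_all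
  have exponent: "?q ^ (?d * k) - 1 = l * (?e * (\<Sum>i<k. (?q ^ ?d) ^ i))" for k
    using geometric_sum_factor[of "?q ^ ?d" k] power_card_minus_1[of ?d] by (simp add: power_mult)
  have deg: "degree (inflate l Q) = l * ?d" by (rule degree_inflate)
  have "degree (inflate l Q) > 0" using deg d l_pos by simp
  then obtain g where g: "g \<in> monic_irreducibles" "g dvd inflate l Q"
    by (rule monic_irreducible_dvd_exists)
  obtain k where k: "degree g = ?d * k"
    using degree_dvd_degree_factor_inflate[OF Q(1) g] by (elim dvdE)
  have "g \<noteq> X" using factor_inflate_neq_X[OF Q l_pos g(2)] .
  then have "g dvd monom 1 (?q ^ degree g - 1) - 1" by (rule fermat_mod_irreducible[OF g(1)])
  then have "g dvd inflate l (monom 1 (?e * (\<Sum>i<k. (?q ^ ?d) ^ i)) - 1)"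
    unfolding k exponent inflate_monom_diff .
  then have "Q dvd monom 1 (?e * (\<Sum>i<k. (?q ^ ?d) ^ i)) - 1"
    by (rule dvd_if_inflations_share_monic_irreducible[OF Q(1) g])
  then have "l dvd (\<Sum>i<k. (?q ^ ?d) ^ i)" using nonpower_not_dvd[OF assms] by blast
  then have "l dvd k" using cong_dvd_iff[OF geometric_sum_cong[OF z(1), of k]] by simp
  moreover have "k > 0" using k monic_irreducible_degree_pos[OF g(1)] by (cases k) auto
  ultimately have "l * ?d \<le> degree g" using k by (simp add: dvd_imp_le)
  have lc: "lead_coeff (inflate l Q) = 1"
    using Q l_pos by (simp add: lead_coeff_inflate monic_irreducibles_def)
  obtain c where c: "inflate l Q = g * c" using g(2) by (elim dvdE)
  have nz: "inflate l Q \<noteq> 0" using deg d l_pos by auto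
  then have "degree (inflate l Q) = degree g + degree c" using c by (auto simp: degree_mult_eq)
  then have "degree c = 0" using \<open>l * ?d \<le> degree g\<close> deg by simp
  then obtain a where a: "c = [:a:]" by (metis degree_eq_zeroE)
  have "lead_coeff c = 1" using lc c g(1) by (simp add: lead_coeff_mult monic_irreducibles_def)
  then have "inflate l Q = g" using a c by (simp add: pCons_one)
  then have irr: "inflate l Q \<in> monic_irreducibles" using g by simp
  have "inflate l Q \<noteq> X"
    using \<open>inflate l Q = g\<close> \<open>g \<noteq> X\<close> by simp
  moreover have "\<not> inflate l Q dvd monom 1 ((?q ^ (l * ?d) - 1) div l) - 1"
  proof
    assume dv: "inflate l Q dvd monom 1 ((?q ^ (l * ?d) - 1) div l) - 1"
    have "l dvd (\<Sum>i<l. (?q ^ ?d) ^ i)" using cong_dvd_iff[OF geometric_sum_cong[OF z(1), of l]] by simp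
    then obtain u where u: "(\<Sum>i<l. (?q ^ ?d) ^ i) = l * u" by (elim dvdE)
    have "\<not> l dvd u"
      using not_square_dvd_geometric_sum[OF prime_l z(1) z(2) z(3)] u
      by (auto simp: power2_eq_square)
    moreover have "(?q ^ (l * ?d) - 1) div l = l * (?e * u)"
      using exponent[of l] l_pos by (simp add: u mult.commute mult.left_commute)
    then have "inflate l Q dvd inflate l (monom 1 (?e * u) - 1)"
      using dv by (simp only: inflate_monom_diff)
    then have "Q dvd monom 1 (?e * u) - 1"
      using dvd_if_inflations_share_monic_irreducible[OF Q(1) irr dvd_refl] by blast
    ultimately show False using nonpower_not_dvd[OF assms] by blast
  qed
  ultimately show ?thesis using irr unfolding nonpower_def deg by blast
qed

lemma nonpower_inflate_power: "nonpower Q \<Longrightarrow> nonpower (inflate (l ^ j) Q)"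
proof (induction j)
  case (Suc j)
  then show ?case using nonpower_inflate[of "inflate (l ^ j) Q"] by (simp add: inflate_inflate)
qed simp

text \<open>
  The last hypothesis puts all \<open>n\<close>-th roots of the roots of \<open>Q\<close> into the field with \<open>q ^ degree Q\<close>
  elements.
\<close>
lemma degree_factor_inflate_eq:
  fixes Q g :: "'a poly"
  assumes "Q \<in> monic_irreducibles" "g \<in> monic_irreducibles" "g dvd inflate n Q"
    and "inflate n Q dvd monom 1 (CARD('a) ^ degree Q - 1) - 1"
  shows "degree g = degree Q"
proof (rule dvd_antisym)
  let ?q = "CARD('a)"
  have "g dvd monom 1 (?q ^ degree Q - 1) - 1" using assms(3,4) by (rule dvd_trans)
  then have "g dvd X * (monom 1 (?q ^ degree Q - 1) - 1)" by (rule dvd_mult)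
  also have "\<dots> = monom 1 (?q ^ degree Q) - X" by (simp add: right_diff_distrib mult_monom)
  finally show "degree g dvd degree Q" by (rule degree_dvd_of_dvd_X_pow[OF assms(2)])
qed (rule degree_dvd_degree_factor_inflate[OF assms(1-3)])

text \<open>
  If the root of \<open>Q\<close> is no \<open>l\<close>-th power, then \<open>g\<close> is the whole polynomial \<open>inflate (l ^ i) Q\<close>.
  Otherwise the factors of \<open>inflate l Q\<close> have the degree of \<open>Q\<close>, and one of them can replace \<open>Q\<close> with
  \<open>i\<close> lowered by one.
\<close>
lemma factor_inflate_power_form:
  fixes Q g :: "'a poly"
  assumes "Q \<in> monic_irreducibles" "Q \<noteq> X" "g \<in> monic_irreducibles" "g dvd inflate (l ^ i) Q"
  shows "\<exists>S t. g = inflate (l ^ t) S \<and> degree S \<le> degree Q"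
  using assms
proof (induction i arbitrary: Q)
  case 0
  then have "g = inflate (l ^ 0) Q" using monic_irreducible_dvd_eq[of g Q] by simp
  then show ?case by blast
next
  case (Suc i)
  show ?case
  proof (cases "nonpower Q")
    case True
    then have "inflate (l ^ Suc i) Q \<in> monic_irreducibles" using nonpower_inflate_power nonpower_def by blast
    then have "g = inflate (l ^ Suc i) Q" using Suc.prems monic_irreducible_dvd_eq by blast
    then show ?thesis by blast
  next
    case False
    have "inflate (l ^ Suc i) Q = inflate (l ^ i) (inflate l Q)" by (simp add: inflate_inflate mult.commute)
    moreover have "degree (inflate l Q) > 0"
      using Suc.prems l_pos by (simp add: degree_inflate monic_irreducible_degree_pos)
    then have "inflate l Q \<noteq> 0" by auto
    ultimately obtain p where p: "p \<in> monic_irreducibles" "p dvd inflate l Q" "g dvd inflate (l ^ i) p"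
      using factor_of_inflation[OF monic_irreducible_prime, of g "inflate l Q" "l ^ i"] Suc.prems by metis
    have "inflate l Q dvd inflate l (monom 1 ((CARD('a) ^ degree Q - 1) div l) - 1)"
      using False Suc.prems by (intro dvd_inflate) (simp add: nonpower_def)
    then have "inflate l Q dvd monom 1 (CARD('a) ^ degree Q - 1) - 1"
      using power_card_minus_1 by (simp add: inflate_monom_diff)
    then have "degree p = degree Q" using degree_factor_inflate_eq Suc.prems(1) p by blast
    moreover have "p \<noteq> X" using factor_inflate_neq_X[OF Suc.prems(1,2) l_pos p(2)] .
    ultimately show ?thesis using Suc.IH[OF p(1) _ Suc.prems(3) p(3)] by simp
  qed
qed

text \<open>
  Extract \<open>l\<close>-th roots of a root of \<open>Q\<close> inside the field with \<open>q ^ degree Q\<close> elements as long as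
  possible. The bound on \<open>s\<close> limits how many \<open>Q\<close> can lead to the same \<open>S\<close>.
\<close>
lemma nonpower_core_exists:
  fixes Q :: "'a poly"
  assumes Q: "Q \<in> monic_irreducibles" "Q \<noteq> X"
  shows "\<exists>S s. nonpower S \<and> degree S = degree Q \<and> S dvd inflate (l ^ s) Q \<and> s \<le> CARD('a) * degree Q"
proof -
  let ?q = "CARD('a)" and ?d = "degree Q"
  define T :: "'a poly" where "T = monom 1 (?q ^ ?d - 1) - 1"
  have d: "?d > 0" using Q by (simp add: monic_irreducible_degree_pos)
  have N: "?q ^ ?d - 1 > 0" using one_less_power[of ?q ?d] CARD_field_ge_2[where 'a='a] d by simp
  have degT: "degree T = ?q ^ ?d - 1" unfolding T_def using N
    by (subst diff_conv_add_uminus, subst degree_add_eq_left) (simp_all add: degree_monom_eq)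
  have T0: "T \<noteq> 0" using degT N by auto
  \<comment> \<open>membership of \<open>s\<close> says that \<open>l ^ s\<close>-th roots of the roots of \<open>Q\<close> stay in the field of \<open>q ^ ?d\<close> elements\<close>
  define K where "K = {s. inflate (l ^ s) Q dvd T}"
  have bound: "s \<le> ?q * ?d" if "s \<in> K" for s
  proof -
    have "l ^ s * ?d \<le> ?q ^ ?d - 1"
      using dvd_imp_degree_le[OF _ T0, of "inflate (l ^ s) Q"] that by (simp add: K_def degT degree_inflate)
    moreover have "l ^ s * 1 \<le> l ^ s * ?d" using d by (intro mult_le_mono2) simp
    ultimately have "l ^ s \<le> ?q ^ ?d" by linarith
    moreover have "2 ^ s \<le> l ^ s" using l_ge_2 by (rule power_mono) simp
    moreover have "?q ^ ?d \<le> (2 ^ ?q) ^ ?d" by (intro power_mono) (simp_all add: less_imp_le)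
    ultimately have "(2::nat) ^ s \<le> 2 ^ (?q * ?d)" by (simp add: power_mult)
    then show ?thesis by simp
  qed
  have "0 \<in> K" using fermat_mod_irreducible[OF Q] by (simp add: K_def T_def)
  moreover have "finite K" using bound by (meson finite_nat_set_iff_bounded_le)
  ultimately obtain s where s: "s \<in> K" and mx: "\<And>t. t \<in> K \<Longrightarrow> t \<le> s"
    using Max_in[of K] Max_ge[of K] by blast
  define W :: "'a poly" where "W = monom 1 ((?q ^ ?d - 1) div l) - 1"
  have "inflate l W = T" using power_card_minus_1[of ?d] by (simp add: W_def T_def inflate_monom_diff)
  \<comment> \<open>otherwise \<open>s + 1\<close> would also belong to \<open>K\<close>\<close>
  then have "\<not> inflate (l ^ s) Q dvd W"
    using mx[of "Suc s"] dvd_inflate[of "inflate (l ^ s) Q" W l]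
    by (auto simp: K_def inflate_inflate)
  then obtain S where S: "S \<in> monic_irreducibles" "S dvd inflate (l ^ s) Q" "\<not> S dvd W"
    using dvd_if_prime_factors_dvd[of T "inflate (l ^ s) Q" W] s T0
      not_square_dvd_X_pow_minus_1[OF _ d] unfolding K_def T_def by blast
  have dS: "degree S = ?d"
    using degree_factor_inflate_eq[OF Q(1) S(1,2)] s by (simp add: K_def T_def)
  have "S \<noteq> X" using factor_inflate_neq_X[OF Q _ S(2)] l_pos by simp
  then have "nonpower S" using S dS by (simp add: nonpower_def W_def)
  then show ?thesis using S dS bound[OF s] by blast
qed

end

section \<open>Sparse sets of polynomials\<close>

text \<open>
  Counting by means of an injective encoding of \<open>f\<close> as a pair: this form serves the
  factorisations \<open>p ^ e * g\<close>, the pairs of a constant term and the rest, and the pairs \<open>(S, s)\<close> from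
  \<open>nonpower_core_exists\<close>.
\<close>
lemma sum_le_prod_of_sums:
  fixes u v w :: "_ \<Rightarrow> real"
  assumes "finite A" "finite B" "inj_on (\<lambda>f. (a f, b f)) F" "a ` F \<subseteq> A" "b ` F \<subseteq> B"
    and "\<And>f. f \<in> F \<Longrightarrow> w f \<le> u (a f) * v (b f)" "\<And>x. u x \<ge> 0" "\<And>x. v x \<ge> 0"
  shows "sum w F \<le> sum u A * sum v B"
proof -
  have "sum w F \<le> (\<Sum>f\<in>F. u (a f) * v (b f))" using assms(6) by (rule sum_mono)
  also have "\<dots> = (\<Sum>(x, y)\<in>(\<lambda>f. (a f, b f)) ` F. u x * v y)"
    by (simp add: sum.reindex[OF assms(3)])
  also have "\<dots> \<le> (\<Sum>(x, y)\<in>A \<times> B. u x * v y)"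
    using assms by (intro sum_mono2) auto
  also have "\<dots> = sum u A * sum v B" by (simp add: sum_product sum.cartesian_product)
  finally show ?thesis .
qed

lemma geometric_sum_le: "0 \<le> x \<Longrightarrow> x < 1 \<Longrightarrow> (\<Sum>i\<le>n. x ^ i) \<le> 1 / (1 - x)" for x :: real
  by (subst sum_gp0) (auto simp: divide_simps)

text \<open>
  Bounded finite partial sums express that the power series counting \<open>S\<close> by degree has radius of
  convergence at least \<open>1\<close>, i.e. that \<open>S\<close> has subexponential growth.
\<close>
definition sparse :: "'a :: {field, finite} poly set \<Rightarrow> bool"
  where "sparse S \<longleftrightarrow> (\<forall>x::real. 0 < x \<longrightarrow> x < 1 \<longrightarrow>
    (\<exists>C. \<forall>F. finite F \<longrightarrow> F \<subseteq> S \<longrightarrow> (\<Sum>f\<in>F. x ^ degree f) \<le> C))"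

lemma sparseE:
  assumes "sparse S" "0 < x" "x < (1::real)"
  obtains C where "\<And>F. finite F \<Longrightarrow> F \<subseteq> S \<Longrightarrow> (\<Sum>f\<in>F. x ^ degree f) \<le> C"
  using assms unfolding sparse_def by blast

definition monic_products :: "'a :: {field, finite} poly set \<Rightarrow> 'a poly set"
  where "monic_products S = {f. lead_coeff f = 1 \<and> (\<forall>p\<in>monic_irreducibles. p dvd f \<longrightarrow> p \<in> S)}"

lemma split_off_power:
  fixes p f :: "'a :: {field, finite} poly"
  assumes "p \<in> monic_irreducibles" "lead_coeff f = 1"
  shows "\<exists>e g. f = p ^ e * g \<and> \<not> p dvd g \<and> lead_coeff g = 1"
  using assms(2)
proof (induction "degree f" arbitrary: f rule: less_induct)
  case less
  show ?case
  proof (cases "p dvd f")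
    case True
    then obtain R where R: "f = p * R" by (elim dvdE)
    have "R \<noteq> 0" using R less.prems by auto
    moreover have "lead_coeff R = 1" using R less.prems assms(1) by (simp add: lead_coeff_mult monic_irreducibles_def)
    moreover have "degree R < degree f"
    proof -
      have "p \<noteq> 0" "degree p > 0" using assms(1) by (auto simp: monic_irreducibles_def)
      then show ?thesis using R \<open>R \<noteq> 0\<close> by (simp add: degree_mult_eq)
    qed
    ultimately obtain e g where "R = p ^ e * g" "\<not> p dvd g" "lead_coeff g = 1" using less.hyps by blast
    then have "f = p ^ Suc e * g \<and> \<not> p dvd g \<and> lead_coeff g = 1" using R by simp
    then show ?thesis by blast
  next
    case False
    then have "f = p ^ 0 * f \<and> \<not> p dvd f \<and> lead_coeff f = 1" using less.prems by simp
    then show ?thesis by blast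
  qed
qed

text \<open>
  A finite part of the Euler product: the factor of \<open>p\<close> is the geometric series
  over the powers of \<open>p\<close> in the factorisation.
\<close>
lemma sum_monic_products_le:
  fixes T :: "'a :: {field, finite} poly set"
  assumes "finite T" "T \<subseteq> monic_irreducibles" "0 < x" "x < (1::real)" "finite F" "F \<subseteq> monic_products T"
  shows "(\<Sum>f\<in>F. x ^ degree f) \<le> (\<Prod>p\<in>T. 1 / (1 - x ^ degree p))"
  using assms(1,2,5,6)
proof (induction T arbitrary: F rule: finite_induct)
  case empty
  have "f = 1" if "f \<in> monic_products {}" for f :: "'a poly"
  proof -
    have "degree f = 0" using that monic_irreducible_dvd_exists[of f] by (auto simp: monic_products_def)
    then obtain c where "f = [:c:]" by (metis degree_eq_zeroE)
    then show ?thesis using that by (simp add: monic_products_def pCons_one)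
  qed
  then have "F \<subseteq> {1}" using empty by blast
  then have "(\<Sum>f\<in>F. x ^ degree f) \<le> (\<Sum>f\<in>{1::'a poly}. x ^ degree f)" using assms by (intro sum_mono2) auto
  then show ?case by simp
next
  case (insert p T)
  have p: "p \<in> monic_irreducibles" using insert by simp
  have "\<forall>f\<in>F. \<exists>e g. f = p ^ e * g \<and> \<not> p dvd g \<and> lead_coeff g = 1"
    using split_off_power[OF p] insert.prems by (auto simp: monic_products_def)
  then obtain e g where eg: "\<And>f. f \<in> F \<Longrightarrow> p ^ e f * g f = f \<and> \<not> p dvd g f \<and> lead_coeff (g f) = 1"
    by metis
  have gT: "g ` F \<subseteq> monic_products T"
  proof
    fix y assume "y \<in> g ` F"
    then obtain f where f: "f \<in> F" "y = g f" by blast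
    have "r \<in> T" if r: "r \<in> monic_irreducibles" "r dvd g f" for r
    proof -
      have "r dvd f" using r eg[OF f(1)] by (metis dvd_mult)
      then have "r \<in> insert p T" using r f insert.prems by (auto simp: monic_products_def)
      then show ?thesis using r eg[OF f(1)] by auto
    qed
    then show "y \<in> monic_products T" using eg[OF f(1)] f by (auto simp: monic_products_def)
  qed
  let ?y = "x ^ degree p"
  have y: "0 < ?y" "?y < 1" using assms p by (auto simp: monic_irreducibles_def power_Suc_less_one power_less_one_iff)
  have e_bound: "e ` F \<subseteq> {..Max (e ` F)}" using insert.prems by auto
  have inj: "inj_on (\<lambda>f. (e f, g f)) F"
  proof (rule inj_onI)
    fix f f' assume f: "f \<in> F" "f' \<in> F" "(e f, g f) = (e f', g f')"
    have "f = p ^ e f * g f" using eg[OF f(1)] by (metis)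
    also have "\<dots> = p ^ e f' * g f'" using f(3) by (metis prod.inject)
    also have "\<dots> = f'" using eg[OF f(2)] by (metis)
    finally show "f = f'" .
  qed
  have "x ^ degree f \<le> ?y ^ e f * x ^ degree (g f)" if "f \<in> F" for f
  proof -
    have "degree f = degree p * e f + degree (g f)"
    proof -
      have "p \<noteq> 0" "g f \<noteq> 0" using p eg[OF that] by (auto simp: monic_irreducibles_def)
      then have "degree (p ^ e f * g f) = degree p * e f + degree (g f)"
        by (simp add: degree_mult_eq degree_power_eq)
      then show ?thesis using eg[OF that] by simp
    qed
    then show ?thesis by (simp add: power_add power_mult)
  qed
  then have "(\<Sum>f\<in>F. x ^ degree f) \<le> (\<Sum>i\<le>Max (e ` F). ?y ^ i) * (\<Sum>h\<in>g ` F. x ^ degree h)"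
    using insert.prems assms(3) e_bound inj y
    by (intro sum_le_prod_of_sums[where a = e and b = g]) auto
  also have "\<dots> \<le> 1 / (1 - ?y) * (\<Prod>p\<in>T. 1 / (1 - x ^ degree p))"
    using insert gT y assms(3) by (intro mult_mono insert.IH geometric_sum_le sum_nonneg) auto
  finally show ?case using insert by simp
qed

lemma one_div_one_minus_le_exp:
  fixes x y :: real
  assumes "0 \<le> y" "y \<le> x" "x < 1"
  shows "1 / (1 - y) \<le> exp (y / (1 - x))"
proof -
  have "1 / (1 - y) = 1 + y / (1 - y)" using assms by (simp add: field_simps)
  also have "\<dots> \<le> 1 + y / (1 - x)" using assms by (intro add_left_mono divide_left_mono) auto
  also have "\<dots> \<le> exp (y / (1 - x))" by (rule exp_ge_add_one_self)
  finally show ?thesis .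
qed

lemma finite_monic_irreducible_divisors:
  fixes f :: "'a :: {field, finite} poly"
  assumes "f \<noteq> 0"
  shows "finite {p \<in> monic_irreducibles. p dvd f}"
proof (rule finite_subset)
  show "{p \<in> monic_irreducibles. p dvd f} \<subseteq> {p. p = 0 \<or> degree p < Suc (degree f)}"
    using assms by (auto simp: less_Suc_eq_le dvd_imp_degree_le)
qed (use card_small_polys in blast)

text \<open>
  The Euler product over \<open>S\<close> is bounded by the exponential of the sum over \<open>S\<close>, up to the factor
  \<open>1 / (1 - x)\<close> in the exponent.
\<close>
lemma sparse_monic_products:
  fixes S :: "'a :: {field, finite} poly set"
  assumes "sparse S" "S \<subseteq> monic_irreducibles"
  shows "sparse (monic_products S)"
  unfolding sparse_def
proof (intro allI impI)
  fix x :: real assume x: "0 < x" "x < 1"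
  obtain C where C: "\<And>F. finite F \<Longrightarrow> F \<subseteq> S \<Longrightarrow> (\<Sum>f\<in>F. x ^ degree f) \<le> C"
    using sparseE[OF assms(1) x] by blast
  have "(\<Sum>f\<in>F. x ^ degree f) \<le> exp (C / (1 - x))" if F: "finite F" "F \<subseteq> monic_products S" for F
  proof -
    define T where "T = (\<Union>f\<in>F. {p \<in> monic_irreducibles. p dvd f})"
    have "finite T" unfolding T_def using F
      by (intro finite_UN_I finite_monic_irreducible_divisors) (auto simp: monic_products_def)
    have TS: "T \<subseteq> S" using F by (auto simp: T_def monic_products_def)
    have "F \<subseteq> monic_products T" using F by (auto simp: T_def monic_products_def)
    then have "(\<Sum>f\<in>F. x ^ degree f) \<le> (\<Prod>p\<in>T. 1 / (1 - x ^ degree p))"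
      using \<open>finite T\<close> F x TS assms(2) by (intro sum_monic_products_le) auto
    also have "\<dots> \<le> (\<Prod>p\<in>T. exp (x ^ degree p / (1 - x)))"
    proof (rule prod_mono)
      fix p assume "p \<in> T"
      then have "degree p \<ge> 1" using TS assms(2) by (auto simp: monic_irreducibles_def)
      then have "x ^ degree p \<le> x ^ 1" using x by (intro power_decreasing) auto
      then show "0 \<le> 1 / (1 - x ^ degree p) \<and> 1 / (1 - x ^ degree p) \<le> exp (x ^ degree p / (1 - x))"
        using x by (auto intro!: one_div_one_minus_le_exp)
    qed
    also have "\<dots> = exp ((\<Sum>p\<in>T. x ^ degree p) / (1 - x))"
      by (simp add: exp_sum \<open>finite T\<close> sum_divide_distrib)
    also have "\<dots> \<le> exp (C / (1 - x))" using C[OF \<open>finite T\<close> TS] x by (simp add: divide_right_mono)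
    finally show ?thesis .
  qed
  then show "\<exists>C. \<forall>F. finite F \<longrightarrow> F \<subseteq> monic_products S \<longrightarrow> (\<Sum>f\<in>F. x ^ degree f) \<le> C" by blast
qed

lemma not_sparse_monic_irreducibles: "\<not> sparse (monic_irreducibles :: 'a :: {field, finite} poly set)"
proof
  assume "sparse (monic_irreducibles :: 'a poly set)"
  then have "sparse (monic_products (monic_irreducibles :: 'a poly set))" by (intro sparse_monic_products) auto
  \<comment> \<open>any \<open>x\<close> with \<open>1 / q < x < 1\<close> makes the weight \<open>(q * x) ^ m\<close> of degree \<open>m\<close> unbounded; \<open>3 / 4\<close> does so for all \<open>q \<ge> 2\<close>\<close>
  then obtain C where C: "\<And>F. finite F \<Longrightarrow> F \<subseteq> monic_products (monic_irreducibles :: 'a poly set) \<Longrightarrow>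
      (\<Sum>f\<in>F. (3/4::real) ^ degree f) \<le> C"
    by (rule sparseE[of _ "3/4"]) auto
  have "(3/2::real) ^ m \<le> C" for m
  proof -
    let ?P = "{p :: 'a poly. p = 0 \<or> degree p < m}"
    define G where "G = (\<lambda>p. monom 1 m + p) ` ?P"
    have P: "finite ?P" "card ?P = CARD('a) ^ m" by (rule conjunct1[OF card_small_polys], rule conjunct2[OF card_small_polys])
    have deg: "degree f = m \<and> lead_coeff f = 1" if f: "f \<in> G" for f
    proof -
      obtain p where p: "f = monom 1 m + p" "p = 0 \<or> degree p < m" using f unfolding G_def by (elim imageE CollectE)
      have "degree f = m" using p by (auto simp: degree_monom_eq degree_add_eq_left)
      moreover have "coeff f m = 1" using p by (auto simp: coeff_eq_0)
      ultimately show ?thesis by simp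
    qed
    have "(3/2) ^ m = (2::real) ^ m * (3/4) ^ m" by (simp flip: power_mult_distrib)
    also have "\<dots> \<le> real (CARD('a) ^ m) * (3/4) ^ m"
      using CARD_field_ge_2[where 'a='a] unfolding of_nat_power by (intro mult_right_mono power_mono) auto
    also have "CARD('a) ^ m = card G"
      unfolding G_def P(2)[symmetric] by (rule card_image[symmetric]) (simp add: inj_on_def)
    also have "real (card G) * (3/4) ^ m = (\<Sum>f\<in>G. (3/4) ^ degree f)"
      by (simp add: sum.cong[OF refl, of G "\<lambda>f. (3/4) ^ degree f" "\<lambda>f. (3/4) ^ m"] deg)
    also have "\<dots> \<le> C"
    proof (rule C)
      show "finite G" unfolding G_def using P(1) by (rule finite_imageI)
      show "G \<subseteq> monic_products monic_irreducibles" using deg by (auto simp: monic_products_def)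
    qed
    finally show ?thesis .
  qed
  moreover obtain m where "C < (3/2) ^ m" using real_arch_pow[of "3/2" C] by auto
  ultimately show False by (meson leD)
qed

section \<open>F-sets and their nullity filtration\<close>

lemma minus_const_inflate: "n > 0 \<Longrightarrow> minus_const (inflate n R) = inflate n (minus_const R)"
  by (simp add: minus_const_def pcompose_diff poly_pcompose poly_monom zero_power)

lemma degree_minus_const: "degree (minus_const R) = degree R"
proof (cases "degree R = 0")
  case True
  then show ?thesis unfolding minus_const_def by (metis degree_pCons_0 degree_diff_le le_zero_eq)
next
  case False
  then show ?thesis unfolding minus_const_def
    by (simp add: degree_add_eq_left flip: add_uminus_conv_diff)
qed

lemma lead_coeff_minus_const: "degree R > 0 \<Longrightarrow> lead_coeff (minus_const R) = lead_coeff R"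
  unfolding degree_minus_const by (cases "degree R") (auto simp: minus_const_def)

lemma X_dvd_minus_const: "X dvd minus_const R"
  by (simp add: minus_const_def monom_1_dvd_iff' poly_0_coeff_0)

lemma minus_const_X: "minus_const X = X"
  by (simp add: minus_const_def poly_monom)

lemma nullity_filtration_Suc_iff:
  "f \<in> nullity_filtration A (Suc n) \<longleftrightarrow>
     f \<in> nullity_filtration A n \<and> (\<exists>g\<in>nullity_filtration A n. f dvd minus_const g)"
  by (auto simp: nullity_def)

lemma F_set_nullity_filtration: "F_set A \<Longrightarrow> F_set (nullity_filtration A n)"
proof (induction n)
  case (Suc n)
  then show ?case
    unfolding F_set_def Ball_def[of "nullity_filtration A (Suc n)"] nullity_filtration_Suc_iff subset_iff
    by blast
qed simp

lemma nullity_filtration_add: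
  "nullity_filtration (nullity_filtration A m) n = nullity_filtration A (m + n)"
  by (induction n) simp_all

lemma nullity_filtration_antimono: "m \<le> n \<Longrightarrow> nullity_filtration A n \<subseteq> nullity_filtration A m"
  by (induction n rule: dec_induct) auto

lemma width_eqI:
  assumes "finite (nullity_filtration A n)" "\<And>m. m < n \<Longrightarrow> infinite (nullity_filtration A m)"
  shows "width A = enat n"
proof -
  have "(LEAST n. finite (nullity_filtration A n)) = n"
    using assms by (intro Least_equality) (auto simp: not_less[symmetric])
  then show ?thesis using assms(1) by (auto simp: width_def)
qed

text \<open>
  If \<open>A\<close> has width \<open>w\<close>, take the \<open>(w - r)\<close>-th member of its filtration; its own filtration is
  the tail of that of \<open>A\<close>.
\<close>
lemma F_set_of_width_exists:
  assumes A: "F_set A" "finite (nullity_filtration A D)" and r: "r \<ge> 1" "infinite (nullity_filtration A r)"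
  obtains B where "B \<subseteq> A" "F_set B" "infinite B" "width B = enat r"
proof -
  define w where "w = (LEAST n. finite (nullity_filtration A n))"
  have fin: "finite (nullity_filtration A w)" unfolding w_def using A(2) by (rule LeastI)
  have inf: "infinite (nullity_filtration A m)" if "m < w" for m
    using that unfolding w_def by (rule not_less_Least)
  have "r \<le> w" using r(2) fin nullity_filtration_antimono[of w r A] by (meson finite_subset nat_le_linear)
  let ?B = "nullity_filtration A (w - r)"
  have "width ?B = enat r"
    using fin inf \<open>r \<le> w\<close> by (intro width_eqI) (auto simp: nullity_filtration_add)
  moreover have "infinite ?B" using inf[of "w - r"] r(1) \<open>r \<le> w\<close> by simp
  moreover have "F_set ?B" by (rule F_set_nullity_filtration[OF A(1)])
  moreover have "?B \<subseteq> A" using nullity_filtration_antimono[of 0 "w - r" A] by simp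
  ultimately show thesis using that by blast
qed

definition descent :: "('a :: {field, finite} poly \<times> 'a poly) set"
  where "descent = {(f, g). f \<in> monic_irreducibles \<and> g \<in> monic_irreducibles \<and> g dvd minus_const f}"

text \<open>
  An element survives a step of the filtration as soon as it lies below a survivor of the previous
  step.
\<close>
lemma end_of_descent_in_filtration:
  assumes "F_set A" "h \<in> A" "(h, b) \<in> descent ^^ k"
  shows "b \<in> nullity_filtration A k"
  using assms(3)
proof (induction k arbitrary: b)
  case (Suc k)
  then obtain c where c: "(h, c) \<in> descent ^^ k" "(c, b) \<in> descent" by auto
  have "c \<in> nullity_filtration A k" using Suc.IH[OF c(1)] .
  then have "b \<in> nullity_filtration A k"
    using c(2) F_set_nullity_filtration[OF assms(1), of k] by (auto simp: F_set_def descent_def)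
  with \<open>c \<in> nullity_filtration A k\<close> c(2) show ?case
    unfolding nullity_filtration_Suc_iff by (auto simp: descent_def)
qed (use assms(2) in simp)

section \<open>F-sets of bounded index\<close>

context kummer_prime
begin

text \<open>
  \<open>X\<close> has to be added by hand only for \<open>D = 0\<close>, which makes this value the trivial end of the
  filtration.
\<close>
definition bounded_index :: "nat \<Rightarrow> 'a poly set"
  where "bounded_index D =
    insert X {h \<in> monic_irreducibles. \<exists>R t. h = inflate (l ^ t) R \<and> degree R \<le> D}"

text \<open>
  \<open>g\<close> divides \<open>inflate (l ^ t) p\<close> for an irreducible factor \<open>p \<noteq> X\<close> of \<open>R - R(0)\<close>. The degree of \<open>p\<close> is
  smaller than that of \<open>R\<close> since \<open>X\<close> is a further factor.
\<close>
lemma index_decreases: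
  fixes R :: "'a poly"
  assumes h: "inflate (l ^ t) R \<in> monic_irreducibles"
    and g: "g \<in> monic_irreducibles" "g \<noteq> X" "g dvd minus_const (inflate (l ^ t) R)"
  shows "\<exists>S u. g = inflate (l ^ u) S \<and> degree S < degree R"
proof -
  have n: "l ^ t > 0" using l_pos by simp
  have dR: "degree R > 0" using monic_irreducible_degree_pos[OF h] by (simp add: degree_inflate)
  then have nz: "minus_const R \<noteq> 0" using degree_minus_const[of R] by auto
  have "g dvd inflate (l ^ t) (minus_const R)" using g(3) minus_const_inflate[OF n] by metis
  then obtain p where p: "p \<in> monic_irreducibles" "p dvd minus_const R" "g dvd inflate (l ^ t) p"
    using factor_of_inflation[OF monic_irreducible_prime[OF g(1)] nz] by blast
  have "p \<noteq> X"
  proof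
    assume "p = X"
    then have "g dvd X ^ (l ^ t)" using p(3) by (simp add: inflate_monom monom_power)
    then have "g dvd X" using monic_irreducible_prime[OF g(1)] prime_elem_dvd_power by blast
    with not_dvd_X[OF g(1,2)] show False ..
  qed
  obtain K where K: "minus_const R = p * K" using p(2) by (elim dvdE)
  have "\<not> X dvd p" using monic_irreducible_dvd_eq[OF X_monic_irreducible p(1)] \<open>p \<noteq> X\<close> by blast
  moreover have "X dvd p * K" using X_dvd_minus_const[of R] K by metis
  ultimately have "X dvd K"
    using prime_elem_dvd_mult_iff[OF monic_irreducible_prime[OF X_monic_irreducible]] by blast
  moreover have "K \<noteq> 0" "p \<noteq> 0" using nz K by auto
  ultimately have "degree K \<ge> 1" using dvd_imp_degree_le[of X K] by (simp add: degree_monom_eq)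
  moreover have "degree R = degree p + degree K"
    using K \<open>K \<noteq> 0\<close> \<open>p \<noteq> 0\<close> by (metis degree_minus_const degree_mult_eq)
  ultimately have "degree p < degree R" by simp
  moreover obtain S u where "g = inflate (l ^ u) S" "degree S \<le> degree p"
    using factor_inflate_power_form[OF p(1) \<open>p \<noteq> X\<close> g(1) p(3)] by blast
  ultimately show ?thesis by (intro exI[of _ S] exI[of _ u]) simp
qed

lemma bounded_index_descends:
  assumes "h \<in> bounded_index D" "g \<in> monic_irreducibles" "g dvd minus_const h"
  shows "g \<in> bounded_index (D - 1)"
proof (cases "g = X")
  case False
  have "h \<noteq> X"
    using assms(2,3) False not_dvd_X minus_const_X by metis
  then obtain R t where R: "h = inflate (l ^ t) R" "degree R \<le> D" "h \<in> monic_irreducibles"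
    using assms(1) by (auto simp: bounded_index_def)
  then obtain S u where "g = inflate (l ^ u) S" "degree S < degree R"
    using index_decreases[of R t g] assms False by blast
  then show ?thesis using assms(2) R by (auto simp: bounded_index_def)
qed (simp add: bounded_index_def)

lemma bounded_index_mono: "D \<le> D' \<Longrightarrow> bounded_index D \<subseteq> bounded_index D'"
  by (auto simp: bounded_index_def)

lemma F_set_bounded_index: "F_set (bounded_index D)"
  unfolding F_set_def
proof (intro conjI ballI impI)
  show "bounded_index D \<subseteq> monic_irreducibles" using X_monic_irreducible by (auto simp: bounded_index_def)
qed (use bounded_index_descends bounded_index_mono[of "D - 1" D] in auto)

lemma filtration_bounded_index: "nullity_filtration (bounded_index D) n \<subseteq> bounded_index (D - n)"
proof (induction n)
  case (Suc n)
  have "f \<in> bounded_index (D - Suc n)" if f: "f \<in> nullity_filtration (bounded_index D) (Suc n)" for f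
  proof -
    obtain g where "g \<in> bounded_index (D - n)" "f dvd minus_const g"
      using f Suc unfolding nullity_filtration_Suc_iff by blast
    moreover have "f \<in> monic_irreducibles"
      using f F_set_nullity_filtration[OF F_set_bounded_index] F_set_def by blast
    ultimately show ?thesis using bounded_index_descends[of g "D - n" f] by simp
  qed
  then show ?case by blast
qed simp

lemma bounded_index_0: "bounded_index 0 = {X}"
proof -
  have "inflate (l ^ t) R \<notin> monic_irreducibles" if "degree R = 0" for R :: "'a poly" and t
    using that monic_irreducible_degree_pos[of "inflate (l ^ t) R"] by (auto simp: degree_inflate)
  then show ?thesis by (auto simp: bounded_index_def)
qed

lemma finite_filtration_bounded_index: "finite (nullity_filtration (bounded_index D) D)"
  using filtration_bounded_index[of D D] bounded_index_0 by (simp add: finite_subset)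

section \<open>Long descents with infinitely many ends\<close>

text \<open>
  The growing degree of the end \<open>b\<close> guarantees infinitely many different ends. Existence of long
  descents alone would not: they could all end in the same linear polynomial.
\<close>
definition deep :: "nat \<Rightarrow> 'a poly \<Rightarrow> bool"
  where "deep k Q \<longleftrightarrow> (\<forall>N. \<exists>j h b. h \<in> monic_irreducibles \<and> h dvd inflate (l ^ j) Q \<and>
    (h, b) \<in> descent ^^ k \<and> degree b \<ge> N)"

lemma deep_imp_infinite_filtration:
  assumes "deep k Q" "F_set A"
    and A: "\<And>j h. h \<in> monic_irreducibles \<Longrightarrow> h dvd inflate (l ^ j) Q \<Longrightarrow> h \<in> A"
  shows "infinite (nullity_filtration A k)"
proof
  assume fin: "finite (nullity_filtration A k)"
  obtain j h b where b: "h \<in> monic_irreducibles" "h dvd inflate (l ^ j) Q" "(h, b) \<in> descent ^^ k"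
    "degree b \<ge> Suc (Max (degree ` nullity_filtration A k))"
    using assms(1) unfolding deep_def by blast
  then have "b \<in> nullity_filtration A k"
    using end_of_descent_in_filtration[OF assms(2) A] by blast
  then have "degree b \<le> Max (degree ` nullity_filtration A k)" using fin by simp
  with b(4) show False by simp
qed

lemma deep_of_factor:
  assumes "deep k S" "S dvd inflate (l ^ s) Q"
  shows "deep k Q"
  unfolding deep_def
proof
  fix N
  obtain j h b where b: "h \<in> monic_irreducibles" "h dvd inflate (l ^ j) S" "(h, b) \<in> descent ^^ k"
    "degree b \<ge> N"
    using assms(1) unfolding deep_def by blast
  have "inflate (l ^ j) S dvd inflate (l ^ (j + s)) Q"
    using dvd_inflate[OF assms(2), of "l ^ j"] by (simp add: inflate_inflate power_add)
  then show "\<exists>j h b. h \<in> monic_irreducibles \<and> h dvd inflate (l ^ j) Q \<and>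
    (h, b) \<in> descent ^^ k \<and> degree b \<ge> N"
    using b dvd_trans by blast
qed

lemma nonpower_deep_0:
  assumes "nonpower S"
  shows "deep 0 S"
  unfolding deep_def
proof
  fix N
  have irr: "inflate (l ^ N) S \<in> monic_irreducibles"
    using nonpower_inflate_power[OF assms] by (simp add: nonpower_def)
  have "N < 2 ^ N" by (rule less_exp)
  also have "\<dots> \<le> l ^ N" using l_ge_2 by (rule power_mono) simp
  also have "\<dots> \<le> l ^ N * degree S" using assms monic_irreducible_degree_pos[of S] by (simp add: nonpower_def)
  finally have "N \<le> degree (inflate (l ^ N) S)" by (simp add: degree_inflate)
  with irr show "\<exists>j h b. h \<in> monic_irreducibles \<and> h dvd inflate (l ^ j) S \<and>
      (h, b) \<in> descent ^^ 0 \<and> degree b \<ge> N"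
    by (metis dvd_refl pair_in_Id_conv relpow.simps(1))
qed

text \<open>
  Put \<open>inflate (l ^ j) S\<close> on top of a descent that starts from a factor of \<open>inflate (l ^ j) p\<close>.
\<close>
lemma nonpower_deep_Suc:
  assumes S: "nonpower S" and p: "p dvd minus_const S" "deep k p"
  shows "deep (Suc k) S"
  unfolding deep_def
proof
  fix N
  obtain j h b where b: "h \<in> monic_irreducibles" "h dvd inflate (l ^ j) p" "(h, b) \<in> descent ^^ k"
    "degree b \<ge> N"
    using p(2) unfolding deep_def by blast
  let ?f = "inflate (l ^ j) S"
  have f: "?f \<in> monic_irreducibles" using nonpower_inflate_power[OF S] by (simp add: nonpower_def)
  have "h dvd minus_const ?f"
    using dvd_trans[OF b(2) dvd_inflate[OF p(1)]] l_pos by (simp add: minus_const_inflate)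
  then have "(?f, b) \<in> descent ^^ Suc k"
    using f b by (intro relpow_Suc_I2) (auto simp: descent_def)
  then show "\<exists>j h b. h \<in> monic_irreducibles \<and> h dvd inflate (l ^ j) S \<and>
      (h, b) \<in> descent ^^ Suc k \<and> degree b \<ge> N"
    using f b(4) dvd_refl by blast
qed

text \<open>
  Each \<open>Q \<noteq> X\<close> is determined by its core \<open>S\<close> and the exponent \<open>s\<close>, and \<open>S\<close> is not \<open>k\<close>-deep if \<open>Q\<close> is
  not. As \<open>s\<close> is at most \<open>q\<close> times the degree, part of the weight \<open>x ^ degree Q\<close> can be spent on a
  convergent geometric series over \<open>s\<close>.
\<close>
lemma sparse_of_sparse_nonpower:
  assumes "sparse {S. nonpower S \<and> \<not> deep k S}"
  shows "sparse {Q \<in> monic_irreducibles. \<not> deep k Q}"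
  unfolding sparse_def
proof (intro allI impI)
  let ?q = "CARD('a)"
  fix x :: real assume x: "0 < x" "x < 1"
  \<comment> \<open>half of the weight, \<open>z ^ q\<close>, pays for the sum over \<open>s\<close>, the other half \<open>y\<close> for the sum over \<open>S\<close>\<close>
  define z where "z = root (2 * ?q) x"
  define y where "y = z ^ ?q"
  have z: "0 < z" "z < 1" using x by (simp_all add: z_def)
  have y: "0 < y" "y < 1" using z by (simp_all add: y_def power_less_one_iff)
  have xzy: "x = z ^ ?q * y" using x by (simp add: z_def y_def flip: power_add mult_2)
  obtain C where C: "\<And>F. finite F \<Longrightarrow> F \<subseteq> {S. nonpower S \<and> \<not> deep k S} \<Longrightarrow> (\<Sum>f\<in>F. y ^ degree f) \<le> C"
    using sparseE[OF assms y] by blast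
  have "(\<Sum>f\<in>F. x ^ degree f) \<le> 1 + C * (1 / (1 - z))"
    if F: "finite F" "F \<subseteq> {Q \<in> monic_irreducibles. \<not> deep k Q}" for F
  proof -
    have "\<forall>Q\<in>F - {X}. \<exists>S s. nonpower S \<and> degree S = degree Q \<and> S dvd inflate (l ^ s) Q \<and> s \<le> ?q * degree Q"
      using F nonpower_core_exists by blast
    then obtain core e where core: "\<And>Q. Q \<in> F - {X} \<Longrightarrow> nonpower (core Q) \<and> degree (core Q) = degree Q \<and>
        core Q dvd inflate (l ^ e Q) Q \<and> e Q \<le> ?q * degree Q"
      by metis
    have inj: "inj_on (\<lambda>Q. (core Q, e Q)) (F - {X})"
    proof (rule inj_onI)
      fix Q Q' assume Q: "Q \<in> F - {X}" "Q' \<in> F - {X}" "(core Q, e Q) = (core Q', e Q')"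
      then have "core Q dvd inflate (l ^ e Q) Q" "core Q dvd inflate (l ^ e Q) Q'"
        using core[OF Q(1)] core[OF Q(2)] by simp_all
      then have "Q dvd Q'"
        using dvd_if_inflations_share_monic_irreducible[of Q "core Q"] core[OF Q(1)] Q(1) F
        by (auto simp: nonpower_def)
      then show "Q = Q'" using monic_irreducible_dvd_eq Q F by blast
    qed
    have "x ^ degree Q \<le> y ^ degree (core Q) * z ^ e Q" if "Q \<in> F - {X}" for Q
    proof -
      have "x ^ degree Q = y ^ degree Q * z ^ (?q * degree Q)"
        by (simp add: xzy power_mult_distrib power_mult)
      also have "\<dots> \<le> y ^ degree Q * z ^ e Q"
        using core[OF that] y z by (intro mult_left_mono power_decreasing) auto
      finally show ?thesis using core[OF that] by simp
    qed
    then have "(\<Sum>Q\<in>F - {X}. x ^ degree Q) \<le> (\<Sum>S\<in>core ` (F - {X}). y ^ degree S) * (\<Sum>s\<le>Max (e ` (F - {X})). z ^ s)"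
    proof (intro sum_le_prod_of_sums[where a = core and b = e])
      show "e ` (F - {X}) \<subseteq> {..Max (e ` (F - {X}))}"
        using F(1) by (meson Max_ge atMost_iff finite_Diff finite_imageI subsetI)
    qed (use F y z inj in auto)
    also have "\<dots> \<le> C * (1 / (1 - z))"
    proof (rule mult_mono)
      have "core ` (F - {X}) \<subseteq> {S. nonpower S \<and> \<not> deep k S}"
        using core F deep_of_factor by blast
      then show "(\<Sum>S\<in>core ` (F - {X}). y ^ degree S) \<le> C" using F by (intro C) auto
      show "0 \<le> C" using C[of "{}"] by simp
    qed (use z in \<open>auto intro!: geometric_sum_le sum_nonneg\<close>)
    finally have *: "(\<Sum>Q\<in>F - {X}. x ^ degree Q) \<le> C * (1 / (1 - z))" .
    have "(\<Sum>Q\<in>F. x ^ degree Q) \<le> (\<Sum>Q\<in>insert X (F - {X}). x ^ degree Q)"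
      using F x by (intro sum_mono2) auto
    also have "\<dots> \<le> 1 + (\<Sum>Q\<in>F - {X}. x ^ degree Q)"
      using F by (subst sum.insert) (use x in \<open>simp_all add: degree_monom_eq\<close>)
    finally show ?thesis using * by simp
  qed
  then show "\<exists>C. \<forall>F. finite F \<longrightarrow> F \<subseteq> {Q \<in> monic_irreducibles. \<not> deep k Q} \<longrightarrow> (\<Sum>f\<in>F. x ^ degree f) \<le> C"
    by blast
qed

text \<open>
  By \<open>nonpower_deep_Suc\<close>, \<open>S - S(0)\<close> is a product of irreducible polynomials that are not \<open>k\<close>-deep,
  and each such product arises from at most \<open>q\<close> polynomials \<open>S\<close>.
\<close>
lemma sparse_nonpower_Suc:
  assumes "sparse {Q \<in> monic_irreducibles. \<not> deep k Q}"
  shows "sparse {S. nonpower S \<and> \<not> deep (Suc k) S}"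
  unfolding sparse_def
proof (intro allI impI)
  fix x :: real assume x: "0 < x" "x < 1"
  let ?M = "monic_products {Q \<in> monic_irreducibles. \<not> deep k Q}"
  have "sparse ?M" by (rule sparse_monic_products[OF assms]) blast
  then obtain C where C: "\<And>F. finite F \<Longrightarrow> F \<subseteq> ?M \<Longrightarrow> (\<Sum>f\<in>F. x ^ degree f) \<le> C"
    using sparseE[OF _ x] by blast
  have "(\<Sum>f\<in>F. x ^ degree f) \<le> real CARD('a) * C"
    if F: "finite F" "F \<subseteq> {S. nonpower S \<and> \<not> deep (Suc k) S}" for F
  proof -
    have "minus_const S \<in> ?M" if "S \<in> F" for S
    proof -
      have S: "nonpower S" "\<not> deep (Suc k) S" using that F by auto
      then have "lead_coeff S = 1" "degree S > 0" by (auto simp: nonpower_def monic_irreducibles_def)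
      then show ?thesis using nonpower_deep_Suc[OF S(1)] S(2)
        by (auto simp: monic_products_def lead_coeff_minus_const)
    qed
    then have "(\<Sum>g\<in>minus_const ` F. x ^ degree g) \<le> C" using F by (intro C) auto
    moreover have "(\<Sum>f\<in>F. x ^ degree f) \<le> (\<Sum>a\<in>(UNIV :: 'a set). 1) * (\<Sum>g\<in>minus_const ` F. x ^ degree g)"
    proof (rule sum_le_prod_of_sums[where a = "\<lambda>f. poly f 0" and b = minus_const])
      show "inj_on (\<lambda>f. (poly f 0, minus_const f)) F"
        by (rule inj_onI) (auto simp: minus_const_def)
    qed (use F x in \<open>auto simp: degree_minus_const\<close>)
    ultimately show ?thesis by (simp add: mult_left_mono order.trans)
  qed
  then show "\<exists>C. \<forall>F. finite F \<longrightarrow> F \<subseteq> {S. nonpower S \<and> \<not> deep (Suc k) S} \<longrightarrow> (\<Sum>f\<in>F. x ^ degree f) \<le> C"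
    by blast
qed

lemma sparse_not_deep: "sparse {Q \<in> monic_irreducibles. \<not> deep k Q}"
proof (induction k)
  case 0
  have empty: "{S. nonpower S \<and> \<not> deep 0 S} = {}" using nonpower_deep_0 by blast
  have "sparse {S. nonpower S \<and> \<not> deep 0 S}"
    unfolding empty sparse_def by (intro allI impI exI[of _ 0]) simp
  then show ?case by (rule sparse_of_sparse_nonpower)
next
  case (Suc k)
  then show ?case by (rule sparse_of_sparse_nonpower[OF sparse_nonpower_Suc])
qed

text \<open>
  The polynomials that are not deep form a sparse set, but the set of all irreducible ones is not sparse.
\<close>
lemma deep_exists: "\<exists>Q \<in> monic_irreducibles. deep k Q"
proof (rule ccontr)
  assume "\<not> ?thesis"
  then have "{Q \<in> monic_irreducibles. \<not> deep k Q} = monic_irreducibles" by blast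
  then show False using sparse_not_deep[of k] not_sparse_monic_irreducibles[where 'a='a] by simp
qed

section \<open>F-sets of prescribed width\<close>

text \<open>
  The witness \<open>B\<close> is not the set of all irreducible polynomials, because the latter contains the
  descents of an \<open>r\<close>-deep polynomial, and then the \<open>r\<close>-th member of its filtration would be infinite.
\<close>
lemma infinite_nontrivial_F_set_of_width:
  assumes "r \<ge> 1"
  shows "\<exists>A :: 'a poly set. infinite A \<and> nontrivial_F_set A \<and> width A = enat r"
proof -
  obtain Q where Q: "Q \<in> monic_irreducibles" "deep r Q" using deep_exists by blast
  let ?A = "bounded_index (degree Q)"
  have in_A: "h \<in> ?A" if h: "h \<in> monic_irreducibles" "h dvd inflate (l ^ j) Q" for j h
  proof (cases "h = X")
    case False
    have "Q \<noteq> X"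
    proof
      assume "Q = X"
      then have "h dvd X ^ (l ^ j)" using h(2) by (simp add: inflate_monom monom_power)
      then have "h dvd X" using monic_irreducible_prime[OF h(1)] prime_elem_dvd_power by blast
      with not_dvd_X[OF h(1) False] show False ..
    qed
    then show ?thesis using factor_inflate_power_form[OF Q(1) _ h] h(1) by (auto simp: bounded_index_def)
  qed (simp add: bounded_index_def)
  have "infinite (nullity_filtration ?A r)"
    using deep_imp_infinite_filtration[OF Q(2) F_set_bounded_index in_A] .
  then obtain B where B: "B \<subseteq> ?A" "F_set B" "infinite B" "width B = enat r"
    using F_set_of_width_exists[OF F_set_bounded_index finite_filtration_bounded_index assms] by blast
  have "B \<noteq> monic_irreducibles"
  proof
    assume eq: "B = monic_irreducibles"
    have "infinite (nullity_filtration B r)"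
      using deep_imp_infinite_filtration[OF Q(2) B(2)] unfolding eq by blast
    moreover have "finite (nullity_filtration B r)"
      using B(4) LeastI_ex[of "\<lambda>n. finite (nullity_filtration B n)"] by (auto simp: width_def split: if_splits)
    ultimately show False by blast
  qed
  then show ?thesis using B by (auto simp: nontrivial_F_set_def)
qed

end

lemma kummer_prime_exists:
  assumes "CARD('a :: {field, finite}) \<noteq> 2" "CARD('a) \<noteq> 3"
  shows "\<exists>l. kummer_prime TYPE('a) l"
proof -
  let ?q = "CARD('a)"
  have q: "?q \<ge> 4" using CARD_field_ge_2[where 'a='a] assms by linarith
  have cong: "[?q = 1] (mod m)" if "m dvd ?q - 1" for m
    using that q by (simp add: cong_altdef_nat)
  show ?thesis
  proof (cases "4 dvd ?q - 1")
    case True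
    then have "2 dvd ?q - 1" by (rule dvd_trans[rotated]) simp
    then have "kummer_prime TYPE('a) 2"
      using cong[of 2] cong[of 4] True by unfold_locales auto
    then show ?thesis ..
  next
    case False
    \<comment> \<open>the odd part of \<open>q - 1\<close>, which is greater than \<open>1\<close> as \<open>q > 3\<close>\<close>
    define m where "m = (if even (?q - 1) then (?q - 1) div 2 else ?q - 1)"
    have m: "odd m" "m dvd ?q - 1" "m \<noteq> 1"
      using False q unfolding m_def by (auto elim!: evenE oddE split: if_splits)
    obtain l where l: "prime l" "l dvd m" using prime_factor_nat[OF m(3)] by blast
    have "l \<noteq> 2" using l m by auto
    then have "kummer_prime TYPE('a) l"
      using l m cong[of l] by unfold_locales (auto intro: dvd_trans)
    then show ?thesis ..
  qed
qed

theorem theorem1p1: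
  fixes r :: nat
  assumes "CARD('a :: {field, finite}) \<noteq> 2" and "CARD('a) \<noteq> 3"
    and "r \<ge> 1"
  shows "\<exists>A :: 'a poly set. infinite A \<and> nontrivial_F_set A \<and> width A = enat r"
proof -
  obtain l where "kummer_prime TYPE('a) l" using kummer_prime_exists[OF assms(1,2)] by blast
  then show ?thesis using assms(3) by (rule kummer_prime.infinite_nontrivial_F_set_of_width)
qed

end
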